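(* Let $\psi$ be an Orlicz function. Then the Dirac operator $D$ maps $L^{\psi}(\Omega,Cl_n)$ into $W^{-1,\psi}(\Omega,Cl_n)$.
   Context: $\Omega$ is a bounded smooth domain of $\mathbb{R}^n$ whose boundary is at least a $C^1$-hypersurface. $Cl_n$ is the real $2^n$-dimensional Clifford algebra generated by an orthonormal basis $e_1,\dots,e_n$ of $\mathbb{R}^n$ with $e_ie_j+e_je_i=-2\delta_{ij}e_0$, where $e_0$ is the identity; it has basis $\{e_A: A\subset\{1<\dots<n\}\}$, norm $\|\sum_A e_Aa_A\|_{Cl_n}=(\sum_A a_A^2)^{1/2}$, and Clifford conjugation $a\mapsto\overline a$, the linear anti-involution with $\overline{e_j}=-e_j$. A function $f:\Omega\to Cl_n$ is written $f=\sum_A e_Af_A$ with real-valued components $f_A$. The Dirac operator is $D=\sum_{j=1}^n e_j\partial_{x_j}$. An Orlicz function is a function $\psi:[0,\infty)\to[0,\infty)$ that is increasing and convex, with $\psi(0)=0$ and $\lim_{x\to\infty}\psi(x)=\infty$. $L^{\psi}(\Omega,\mathbb{R})$ is the set of locally integrable $f$ such that $\int_\Omega\psi(|f(x)|/\beta)\,dx<\infty$ for some $\beta>0$; $f\in L^{\psi}(\Omega,Cl_n)$ means every component $f_A\in L^{\psi}(\Omega,\mathbb{R})$. $\psi^*$ denotes the conjugate function $\psi^*(t)=\sup_{s\ge0}(st-\psi(s))$. $W^{1,\psi^*}(\Omega,Cl_n)$ is the set of locally integrable $g$ such that for every $A$ there is $\beta_A>0$ with $\sum_{0\le|\alpha|\le1}\int_\Omega\psi^*(|D^\alpha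 g_A(x)|/\beta_A)\,dx<\infty$ ($D^\alpha$ the weak partial derivative), with norm $\sum_A\inf\{\beta>0:\sum_{0\le|\alpha|\le1}\int_\Omega\psi^*(|D^\alpha g_A|/\beta)\,dx\le1\}$; $W_0^{1,\psi^*}(\Omega,Cl_n)$ is its subspace of functions with zero trace on $\partial\Omega$. For $f\in L^\psi(\Omega,Cl_n)$, $Df$ acts on $g\in W_0^{1,\psi^*}(\Omega,Cl_n)$ by $\langle Df,g\rangle=\langle f,Dg\rangle$, where $\langle f,h\rangle=\int_\Omega\overline{f(x)}\,h(x)\,dx$. $W^{-1,\psi}(\Omega,Cl_n)$ is the space of functionals $F$ on $W_0^{1,\psi^*}(\Omega,Cl_n)$ of finite norm $$\|F\|_{W^{-1,\psi}}=\sup\Big\{\frac{|\langle F,g\rangle|}{\|g\|_{W_0^{1,\psi^*}}}: g\ne0,\ g\in W_0^{1,\psi^*}(\Omega,Cl_n)\Big\},$$ with $|\cdot|$ the Clifford norm. *)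

theory Defs
  imports "HOL-Analysis.Analysis"
begin

section \<open>The Clifford algebra\<close>

text \<open>
  An element \<open>\<Sum>\<^sub>A a\<^sub>A e\<^sub>A\<close> is the vector of its coordinates, indexed by the subsets \<open>A\<close> of the
  (finite, linearly ordered) index type \<open>'n\<close>; the dimension is \<open>n = CARD('n)\<close>. The vector
  space structure is the one of \<^typ>\<open>real ^ ('n set)\<close>, and its norm is the Clifford norm
  \<open>(\<Sum>\<^sub>A a\<^sub>A\<^sup>2)\<^sup>1\<^sup>/\<^sup>2\<close>. The product is \<open>cl_mult\<close>, not the componentwise product of vectors.
\<close>

type_synonym 'n clifford = "real ^ ('n set)"

definition cl_basis :: "'n::finite set \<Rightarrow> 'n clifford" where
  "cl_basis A = axis A 1"

text \<open>
  Merging the ordered products \<open>e\<^sub>A\<close> and \<open>e\<^sub>B\<close> costs one sign for every pair \<open>b < a\<close>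
  (transposition) and one for every pair \<open>b = a\<close> (from \<open>e\<^sub>a e\<^sub>a = -1\<close>).
\<close>

definition cl_sign :: "'n::{finite,linorder} set \<Rightarrow> 'n set \<Rightarrow> real" where
  "cl_sign A B = (-1) ^ card {(a, b). a \<in> A \<and> b \<in> B \<and> b \<le> a}"

definition cl_mult :: "'n::{finite,linorder} clifford \<Rightarrow> 'n clifford \<Rightarrow> 'n clifford" where
  "cl_mult x y =
     (\<Sum>A\<in>UNIV. \<Sum>B\<in>UNIV. (x $ A * y $ B * cl_sign A B) *\<^sub>R cl_basis (sym_diff A B))"

definition cl_conj :: "'n::finite clifford \<Rightarrow> 'n clifford" where
  "cl_conj x = (\<chi> A. (-1) ^ (card A * (card A + 1) div 2) * x $ A)"

lemma linear_axis_eqI: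
  fixes f g :: "real ^ 'm \<Rightarrow> 'b::real_vector"
  assumes "linear f" "linear g" "\<And>i. f (axis i 1) = g (axis i 1)"
  shows "f x = g x"
proof -
  have "f = g"
    by (rule linear_eq_stdbasis[OF assms(1,2)]) (auto simp: Basis_vec_def assms(3))
  then show ?thesis by simp
qed

lemma cl_mult_basis:
  "cl_mult (cl_basis A) (cl_basis B) = cl_sign A B *\<^sub>R cl_basis (sym_diff A B)"
proof -
  have "cl_mult (cl_basis A) (cl_basis B) =
      (\<Sum>A'\<in>UNIV. \<Sum>B'\<in>UNIV. if B' = B then (if A' = A then
         cl_sign A' B' *\<^sub>R cl_basis (sym_diff A' B') else 0) else 0)"
    unfolding cl_mult_def
    by (intro sum.cong refl) (auto simp: cl_basis_def axis_def)
  then show ?thesis by simp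
qed

lemma bilinear_cl_mult: "bilinear cl_mult"
  unfolding bilinear_def cl_mult_def
  by (auto intro!: linearI simp: algebra_simps sum.distrib scaleR_sum_right scaleR_add_left
      simp del: scaleR_conv_of_real)

lemma linear_cl_conj: "linear cl_conj"
  by (auto intro!: linearI simp: cl_conj_def vec_eq_iff algebra_simps)

lemma linear_cl_mult_left: "linear (\<lambda>x. cl_mult x y)"
  and linear_cl_mult_right: "linear (\<lambda>y. cl_mult x y)"
  using bilinear_cl_mult by (auto simp: bilinear_def)

lemma cl_sign_eq_prod: "cl_sign A B = (\<Prod>a\<in>A. \<Prod>b\<in>B. if b \<le> a then -1 else 1)"
proof -
  have "{(a, b). a \<in> A \<and> b \<in> B \<and> b \<le> a} = (SIGMA a:A. {b \<in> B. b \<le> a})"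
    by auto
  then have "cl_sign A B = (-1) ^ (\<Sum>a\<in>A. card {b \<in> B. b \<le> a})"
    by (simp add: cl_sign_def card_SigmaI)
  also have "\<dots> = (\<Prod>a\<in>A. (-1) ^ card {b \<in> B. b \<le> a})"
    by (simp add: power_sum)
  also have "\<dots> = (\<Prod>a\<in>A. \<Prod>b\<in>B. if b \<le> a then -1 else 1)"
    by (intro prod.cong refl) (simp add: prod.If_cases Int_def)
  finally show ?thesis .
qed

lemma prod_sym_diff:
  fixes f :: "'a::finite \<Rightarrow> real"
  assumes "\<And>x. f x * f x = 1"
  shows "prod f (sym_diff A B) = prod f A * prod f B"
proof -
  have "prod f A = prod f (A - B) * prod f (A \<inter> B)"
    by (subst prod.union_disjoint[symmetric]) (auto intro!: arg_cong[where f = "prod f"])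
  moreover have "prod f B = prod f (B - A) * prod f (A \<inter> B)"
    by (subst prod.union_disjoint[symmetric]) (auto intro!: arg_cong[where f = "prod f"])
  moreover have "prod f (sym_diff A B) = prod f (A - B) * prod f (B - A)"
    by (subst prod.union_disjoint) auto
  moreover have "prod f (A \<inter> B) * prod f (A \<inter> B) = 1"
    by (simp add: prod.distrib[symmetric] assms)
  ultimately show ?thesis by (simp add: algebra_simps)
qed

lemma cl_sign_square: "cl_sign A B * cl_sign A B = 1"
  by (simp add: cl_sign_def power_add[symmetric])

lemma cl_sign_aux:
  "(\<Prod>b\<in>B. if b \<le> a then -1 else 1) * (\<Prod>b\<in>B. if b \<le> a then -1 else 1) = (1::real)"
  unfolding prod.distrib[symmetric] by (rule prod.neutral) auto

lemma cl_sign_left: "cl_sign (sym_diff A B) C = cl_sign A C * cl_sign B C"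
  unfolding cl_sign_eq_prod
  by (rule prod_sym_diff) (simp add: cl_sign_aux)

lemma cl_sign_right: "cl_sign A (sym_diff B C) = cl_sign A B * cl_sign A C"
  unfolding cl_sign_eq_prod
  by (subst prod_sym_diff) (auto simp: prod.distrib)

lemma cl_mult_assoc: "cl_mult (cl_mult x y) z = cl_mult x (cl_mult y z)"
proof -
  have basis: "cl_mult (cl_mult (axis A 1) (axis B 1)) (axis C 1) =
      cl_mult (axis A 1) (cl_mult (axis B 1) (axis C 1))" for A B C :: "'a set"
  proof -
    have "sym_diff (sym_diff A B) C = sym_diff A (sym_diff B C)" by auto
    then show ?thesis
      unfolding cl_basis_def[symmetric]
      by (simp add: cl_mult_basis linear_cmul[OF linear_cl_mult_left]
          linear_cmul[OF linear_cl_mult_right] cl_sign_left cl_sign_right mult_ac)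
  qed
  note lin = linear_cl_mult_left linear_cl_mult_right
    linear_compose[OF linear_cl_mult_left linear_cl_mult_left, unfolded o_def]
    linear_compose[OF linear_cl_mult_left linear_cl_mult_right, unfolded o_def]
    linear_compose[OF linear_cl_mult_right linear_cl_mult_left, unfolded o_def]
    linear_compose[OF linear_cl_mult_right linear_cl_mult_right, unfolded o_def]
  have "cl_mult (cl_mult (axis A 1) (axis B 1)) z =
      cl_mult (axis A 1) (cl_mult (axis B 1) z)" for A B
    by (rule linear_axis_eqI[where x = z]) (intro lin basis)+
  note basis = this
  have "cl_mult (cl_mult (axis A 1) y) z = cl_mult (axis A 1) (cl_mult y z)" for A
    by (rule linear_axis_eqI[where x = y]) (intro lin basis)+
  note basis = this
  show ?thesis
    by (rule linear_axis_eqI[where x = x]) (intro lin basis)+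
qed

lemma cl_mult_one_left: "cl_mult (cl_basis {}) x = x"
  by (rule linear_axis_eqI[where x = x])
    (use cl_mult_basis[of "{}"] in
      \<open>auto simp: linear_cl_mult_right linear_id[unfolded id_def] cl_basis_def cl_sign_def\<close>)

lemma cl_mult_one_right: "cl_mult x (cl_basis {}) = x"
  by (rule linear_axis_eqI[where x = x])
    (use cl_mult_basis[of _ "{}"] in
      \<open>auto simp: linear_cl_mult_left linear_id[unfolded id_def] cl_basis_def cl_sign_def\<close>)

lemma cl_generator_relation:
  "cl_mult (cl_basis {i}) (cl_basis {j}) + cl_mult (cl_basis {j}) (cl_basis {i}) =
     (if i = j then -2 else 0) *\<^sub>R cl_basis {}"
proof (cases "i = j")
  case True
  then show ?thesis
    by (simp add: cl_mult_basis cl_sign_eq_prod scaleR_2)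
next
  case False
  then have "sym_diff {i} {j} = {i, j}" "sym_diff {j} {i} = {i, j}" by auto
  with False show ?thesis
    by (auto simp: cl_mult_basis cl_sign_eq_prod simp flip: scaleR_left_distrib)
qed

lemma cl_basis_insert:
  assumes "\<And>a. a \<in> A \<Longrightarrow> j < a"
  shows "cl_basis (insert j A) = cl_mult (cl_basis {j}) (cl_basis A)"
proof -
  have "j \<notin> A" using assms by auto
  then have "sym_diff {j} A = insert j A" by auto
  moreover have "cl_sign {j} A = 1"
  proof -
    have "\<not> b \<le> j" if "b \<in> A" for b using assms[OF that] by simp
    then show ?thesis by (simp add: cl_sign_eq_prod)
  qed
  ultimately show ?thesis by (simp add: cl_mult_basis)
qed

lemma cl_sign_self: "cl_sign A A = (-1) ^ (card A * (card A + 1) div 2)"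
proof -
  have "finite A" by simp
  then show ?thesis
  proof (induction A rule: finite_linorder_max_induct)
    case empty
    then show ?case by (simp add: cl_sign_def)
  next
    case (insert m A)
    have m: "m \<notin> A" using insert by auto
    have "cl_sign (insert m A) (insert m A) =
        (\<Prod>b\<in>insert m A. if b \<le> m then -1 else 1) *
        (\<Prod>a\<in>A. \<Prod>b\<in>insert m A. if b \<le> a then -1 else 1)"
      unfolding cl_sign_eq_prod using m by simp
    also have "(\<Prod>b\<in>insert m A. if b \<le> m then -1 else (1::real)) = (\<Prod>b\<in>insert m A. -1)"
      using insert by (intro prod.cong) auto
    also have "(\<Prod>a\<in>A. \<Prod>b\<in>insert m A. if b \<le> a then -1 else (1::real)) =
        (\<Prod>a\<in>A. \<Prod>b\<in>A. if b \<le> a then -1 else 1)"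
    proof (rule prod.cong[OF refl])
      fix a assume "a \<in> A"
      then have "\<not> m \<le> a" using insert by (simp add: not_le)
      then show "(\<Prod>b\<in>insert m A. if b \<le> a then -1 else (1::real)) =
          (\<Prod>b\<in>A. if b \<le> a then -1 else 1)"
        using m by simp
    qed
    finally have "cl_sign (insert m A) (insert m A) = (-1) ^ Suc (card A) * cl_sign A A"
      using m by (simp add: cl_sign_eq_prod)
    moreover have "Suc (card A) * (Suc (card A) + 1) div 2 =
        Suc (card A) + card A * (card A + 1) div 2"
    proof -
      have "Suc (card A) * (Suc (card A) + 1) = card A * (card A + 1) + Suc (card A) * 2"
        by (simp add: algebra_simps)
      then show ?thesis by simp
    qed
    ultimately show ?case using m insert.IH by (simp add: power_add)
  qed
qed

lemma cl_conj_basis: "cl_conj (cl_basis A) = cl_sign A A *\<^sub>R cl_basis A"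
  by (simp add: cl_conj_def cl_basis_def vec_eq_iff axis_def cl_sign_self)

lemma cl_conj_generator: "cl_conj (cl_basis {j :: 'n::{finite,linorder}}) = - cl_basis {j}"
  by (simp add: cl_conj_basis cl_sign_eq_prod)

lemma cl_conj_mult: "cl_conj (cl_mult x y) = cl_mult (cl_conj y) (cl_conj x)"
proof -
  have basis: "cl_conj (cl_mult (axis A 1) (axis B 1)) =
      cl_mult (cl_conj (axis B 1)) (cl_conj (axis A 1))" for A B :: "'a set"
  proof -
    have [simp]: "sym_diff B A = sym_diff A B" by auto
    have "cl_sign A B * (cl_sign (sym_diff A B) (sym_diff A B)) =
        cl_sign A A * cl_sign B B * cl_sign B A * (cl_sign A B * cl_sign A B)"
      by (simp only: cl_sign_left cl_sign_right mult_ac)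
    then show ?thesis
      unfolding cl_basis_def[symmetric]
      by (simp add: cl_mult_basis cl_conj_basis linear_cmul[OF linear_cl_mult_left]
          linear_cmul[OF linear_cl_mult_right] linear_cmul[OF linear_cl_conj] cl_sign_square
          mult_ac)
  qed
  note lin = linear_compose[OF linear_cl_mult_left linear_cl_conj, unfolded o_def]
    linear_compose[OF linear_cl_mult_right linear_cl_conj, unfolded o_def]
    linear_compose[OF linear_cl_conj linear_cl_mult_left, unfolded o_def]
    linear_compose[OF linear_cl_conj linear_cl_mult_right, unfolded o_def]
  have "cl_conj (cl_mult (axis A 1) y) = cl_mult (cl_conj y) (cl_conj (axis A 1))" for A
    by (rule linear_axis_eqI[where x = y]) (intro lin basis)+
  note basis = this
  show ?thesis
    by (rule linear_axis_eqI[where x = x]) (intro lin basis)+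
qed


section \<open>Differentiability and domains\<close>

definition partial :: "'n \<Rightarrow> (real ^ 'n::finite \<Rightarrow> real) \<Rightarrow> real ^ 'n \<Rightarrow> real" where
  "partial j f x = frechet_derivative f (at x) (axis j 1)"

primrec C_k :: "nat \<Rightarrow> (real ^ 'n::finite \<Rightarrow> real) \<Rightarrow> bool" where
  "C_k 0 f \<longleftrightarrow> continuous_on UNIV f"
| "C_k (Suc k) f \<longleftrightarrow> (\<forall>x. f differentiable at x) \<and> (\<forall>j. C_k k (partial j f))"

definition test_functions :: "(real ^ 'n::finite) set \<Rightarrow> (real ^ 'n \<Rightarrow> real) set" where
  "test_functions \<Omega> =
     {\<phi>. (\<forall>k. C_k k \<phi>) \<and> compact (closure {x. \<phi> x \<noteq> 0}) \<and> closure {x. \<phi> x \<noteq> 0} \<subseteq> \<Omega>}"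

text \<open>
  A bounded domain whose boundary is a \<open>C\<^sup>1\<close> hypersurface with the domain locally on one side
  of it, in terms of local defining functions \<open>\<rho>\<close> with nonvanishing gradient \<open>G\<close>.
\<close>

definition bounded_C1_domain :: "(real ^ 'n::finite) set \<Rightarrow> bool" where
  "bounded_C1_domain \<Omega> \<longleftrightarrow>
     open \<Omega> \<and> connected \<Omega> \<and> \<Omega> \<noteq> {} \<and> bounded \<Omega> \<and>
     (\<forall>p\<in>frontier \<Omega>. \<exists>U \<rho> G. open U \<and> p \<in> U \<and>
        (\<forall>x\<in>U. (\<rho> has_derivative (\<lambda>h. G x \<bullet> h)) (at x) \<and> G x \<noteq> 0) \<and>
        continuous_on U G \<and> \<Omega> \<inter> U = {x \<in> U. \<rho> x < (0::real)})"

definition locally_integrable :: "(real ^ 'n::finite) set \<Rightarrow> (real ^ 'n \<Rightarrow> real) \<Rightarrow> bool" where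
  "locally_integrable \<Omega> u \<longleftrightarrow> (\<forall>K. compact K \<and> K \<subseteq> \<Omega> \<longrightarrow> set_integrable lebesgue K u)"

definition has_weak_partial ::
    "(real ^ 'n::finite) set \<Rightarrow> 'n \<Rightarrow> (real ^ 'n \<Rightarrow> real) \<Rightarrow> (real ^ 'n \<Rightarrow> real) \<Rightarrow> bool" where
  "has_weak_partial \<Omega> j u v \<longleftrightarrow>
     locally_integrable \<Omega> u \<and> locally_integrable \<Omega> v \<and>
     (\<forall>\<phi>\<in>test_functions \<Omega>.
        (LINT x:\<Omega>|lebesgue. u x * partial j \<phi> x) = - (LINT x:\<Omega>|lebesgue. v x * \<phi> x))"

text \<open>
  A representative of the weak derivative, which is unique up to null sets. It is only
  meaningful where some \<open>v\<close> with \<open>has_weak_partial \<Omega> j u v\<close> exists.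
\<close>

definition weak_partial ::
    "(real ^ 'n::finite) set \<Rightarrow> 'n \<Rightarrow> (real ^ 'n \<Rightarrow> real) \<Rightarrow> real ^ 'n \<Rightarrow> real" where
  "weak_partial \<Omega> j u = (SOME v. has_weak_partial \<Omega> j u v)"


section \<open>Orlicz and Orlicz--Sobolev spaces\<close>

definition orlicz_function :: "(real \<Rightarrow> real) \<Rightarrow> bool" where
  "orlicz_function \<psi> \<longleftrightarrow>
     (\<forall>t\<ge>0. 0 \<le> \<psi> t) \<and> mono_on {0..} \<psi> \<and> convex_on {0..} \<psi> \<and> \<psi> 0 = 0 \<and>
     filterlim \<psi> at_top at_top"

text \<open>
  The conjugate function may be infinite (e.g. for \<open>\<psi> t = t\<close>), so it takes values in
  \<^typ>\<open>ennreal\<close>. Negative numbers are truncated to \<open>0\<close> by \<^const>\<open>ennreal\<close>; this does not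
  change the supremum, because \<open>s = 0\<close> contributes \<open>0\<close>.
\<close>

definition orlicz_conjugate :: "(real \<Rightarrow> real) \<Rightarrow> real \<Rightarrow> ennreal" where
  "orlicz_conjugate \<psi> t = (SUP s\<in>{0..}. ennreal (s * t - \<psi> s))"

definition orlicz_modular ::
    "(real \<Rightarrow> ennreal) \<Rightarrow> (real ^ 'n::finite) set \<Rightarrow> real \<Rightarrow> (real ^ 'n \<Rightarrow> real) \<Rightarrow> ennreal" where
  "orlicz_modular \<Phi> \<Omega> \<beta> u = (\<integral>\<^sup>+x\<in>\<Omega>. \<Phi> (\<bar>u x\<bar> / \<beta>) \<partial>lebesgue)"

text \<open>
  Functions are defined on all of \<open>\<real>\<^sup>n\<close>, but only their values on \<open>\<Omega>\<close> matter.
\<close>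

definition orlicz_space ::
    "(real \<Rightarrow> real) \<Rightarrow> (real ^ 'n::finite) set \<Rightarrow> (real ^ 'n \<Rightarrow> 'n clifford) set" where
  "orlicz_space \<psi> \<Omega> =
     {f. \<forall>A. locally_integrable \<Omega> (\<lambda>x. f x $ A) \<and>
         (\<exists>\<beta>>0. orlicz_modular (\<lambda>t. ennreal (\<psi> t)) \<Omega> \<beta> (\<lambda>x. f x $ A) < \<infinity>)}"

definition sobolev_modular ::
    "(real \<Rightarrow> ennreal) \<Rightarrow> (real ^ 'n::finite) set \<Rightarrow> real \<Rightarrow> (real ^ 'n \<Rightarrow> real) \<Rightarrow> ennreal" where
  "sobolev_modular \<Phi> \<Omega> \<beta> u =
     orlicz_modular \<Phi> \<Omega> \<beta> u + (\<Sum>j\<in>UNIV. orlicz_modular \<Phi> \<Omega> \<beta> (weak_partial \<Omega> j u))"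

definition sobolev_space ::
    "(real \<Rightarrow> ennreal) \<Rightarrow> (real ^ 'n::finite) set \<Rightarrow> (real ^ 'n \<Rightarrow> 'n clifford) set" where
  "sobolev_space \<Phi> \<Omega> =
     {g. \<forall>A. locally_integrable \<Omega> (\<lambda>x. g x $ A) \<and>
         (\<forall>j. \<exists>v. has_weak_partial \<Omega> j (\<lambda>x. g x $ A) v) \<and>
         (\<exists>\<beta>>0. sobolev_modular \<Phi> \<Omega> \<beta> (\<lambda>x. g x $ A) < \<infinity>)}"

definition sobolev_norm ::
    "(real \<Rightarrow> ennreal) \<Rightarrow> (real ^ 'n::finite) set \<Rightarrow> (real ^ 'n \<Rightarrow> 'n clifford) \<Rightarrow> ennreal" where
  "sobolev_norm \<Phi> \<Omega> g =
     (\<Sum>A\<in>UNIV. INF \<beta>\<in>{\<beta>. 0 < \<beta> \<and> sobolev_modular \<Phi> \<Omega> \<beta> (\<lambda>x. g x $ A) \<le> 1}. ennreal \<beta>)"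


section \<open>Boundary traces\<close>

text \<open>
  The normalised \<open>s\<close>-dimensional Hausdorff measure; for \<open>s = n - 1\<close> it gives the surface measure
  on a \<open>C\<^sup>1\<close> hypersurface, and for \<open>s = 0\<close> the counting measure. By Caratheodory's criterion
  the outer measure is countably additive on the Borel sets, so \<^const>\<open>measure_of\<close> is not
  applied outside its intended domain.
\<close>

definition hausdorff_content :: "nat \<Rightarrow> real \<Rightarrow> 'a::metric_space set \<Rightarrow> ennreal" where
  "hausdorff_content s \<delta> E =
     (INF U\<in>{U :: nat \<Rightarrow> 'a set. E \<subseteq> (\<Union>i. U i) \<and> (\<forall>i. bounded (U i) \<and> diameter (U i) \<le> \<delta>)}.
        \<Sum>i. if U i = {} then 0
            else ennreal (unit_ball_vol (real s) * (diameter (U i) / 2) ^ s))"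

definition hausdorff_measure :: "nat \<Rightarrow> 'a::metric_space measure" where
  "hausdorff_measure s =
     measure_of UNIV (sets borel) (\<lambda>E. SUP \<delta>\<in>{0<..}. hausdorff_content s \<delta> E)"

abbreviation surface_measure :: "(real ^ 'n::finite) measure" where
  "surface_measure \<equiv> hausdorff_measure (CARD('n) - 1)"

text \<open>
  The trace operator \<open>W\<^sup>1\<^sup>,\<^sup>1(\<Omega>) \<rightarrow> L\<^sup>1(\<partial>\<Omega>)\<close>, as a relation: it extends the restriction to the
  boundary continuously from functions that are \<open>C\<^sup>1\<close> up to the boundary. Since \<open>\<Omega>\<close> is bounded,
  \<open>W\<^sup>1\<^sup>,\<^sup>1(\<Omega>)\<close> contains the Orlicz--Sobolev space of the conjugate of an Orlicz function. (Smooth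
  functions need not be norm dense in the latter.)
\<close>

definition has_trace ::
    "(real ^ 'n::finite) set \<Rightarrow> (real ^ 'n \<Rightarrow> real) \<Rightarrow> (real ^ 'n \<Rightarrow> real) \<Rightarrow> bool" where
  "has_trace \<Omega> u T \<longleftrightarrow>
     set_integrable surface_measure (frontier \<Omega>) T \<and>
     (\<exists>w. (\<forall>k. C_k 1 (w k)) \<and>
        (\<lambda>k. (\<integral>\<^sup>+x\<in>\<Omega>. ennreal \<bar>w k x - u x\<bar> \<partial>lebesgue) +
           (\<Sum>j\<in>UNIV. \<integral>\<^sup>+x\<in>\<Omega>. ennreal \<bar>partial j (w k) x - weak_partial \<Omega> j u x\<bar> \<partial>lebesgue))
          \<longlonglongrightarrow> 0 \<and>
        (\<lambda>k :: nat. \<integral>\<^sup>+x\<in>frontier \<Omega>. ennreal \<bar>w k x - T x\<bar> \<partial>surface_measure) \<longlonglongrightarrow> 0)"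

definition sobolev_space_0 ::
    "(real \<Rightarrow> ennreal) \<Rightarrow> (real ^ 'n::finite) set \<Rightarrow> (real ^ 'n \<Rightarrow> 'n clifford) set" where
  "sobolev_space_0 \<Phi> \<Omega> =
     {g \<in> sobolev_space \<Phi> \<Omega>. \<forall>A. has_trace \<Omega> (\<lambda>x. g x $ A) (\<lambda>x. 0)}"


section \<open>The Dirac operator and the negative space\<close>

definition dirac ::
    "(real, 'n::{finite,linorder}) vec set \<Rightarrow> ((real, 'n) vec \<Rightarrow> 'n clifford) \<Rightarrow>
     (real, 'n) vec \<Rightarrow> 'n clifford" where
  "dirac \<Omega> g x =
     (\<Sum>j\<in>UNIV. cl_mult (cl_basis {j}) (\<chi> A. weak_partial \<Omega> j (\<lambda>y. g y $ A) x))"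

definition cl_pairing ::
    "(real, 'n::{finite,linorder}) vec set \<Rightarrow>
     ((real, 'n) vec \<Rightarrow> 'n clifford) \<Rightarrow> ((real, 'n) vec \<Rightarrow> 'n clifford) \<Rightarrow> 'n clifford" where
  "cl_pairing \<Omega> f h = (LINT x:\<Omega>|lebesgue. cl_mult (cl_conj (f x)) (h x))"

definition dirac_functional ::
    "(real \<Rightarrow> real) \<Rightarrow> (real, 'n::{finite,linorder}) vec set \<Rightarrow>
     ((real, 'n) vec \<Rightarrow> 'n clifford) \<Rightarrow> ((real, 'n) vec \<Rightarrow> 'n clifford) \<Rightarrow> 'n clifford" where
  "dirac_functional \<psi> \<Omega> f =
     (\<lambda>g\<in>sobolev_space_0 (orlicz_conjugate \<psi>) \<Omega>. cl_pairing \<Omega> f (dirac \<Omega> g))"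

definition dual_norm ::
    "(real \<Rightarrow> real) \<Rightarrow> (real ^ 'n::finite) set \<Rightarrow>
     ((real ^ 'n \<Rightarrow> 'n clifford) \<Rightarrow> 'n clifford) \<Rightarrow> ennreal" where
  "dual_norm \<psi> \<Omega> F =
     (SUP g\<in>{g \<in> sobolev_space_0 (orlicz_conjugate \<psi>) \<Omega>.
              \<not> (AE x in lebesgue. x \<in> \<Omega> \<longrightarrow> g x = 0)}.
        ennreal (norm (F g)) / sobolev_norm (orlicz_conjugate \<psi>) \<Omega> g)"

text \<open>
  The functionals are real linear maps into the Clifford algebra on classes of functions modulo
  equality almost everywhere. Being extensional means being \<open>undefined\<close> off their domain.
\<close>

definition negative_sobolev_space ::
    "(real \<Rightarrow> real) \<Rightarrow> (real ^ 'n::finite) set \<Rightarrow>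
     ((real ^ 'n \<Rightarrow> 'n clifford) \<Rightarrow> 'n clifford) set" where
  "negative_sobolev_space \<psi> \<Omega> =
     (let W0 = sobolev_space_0 (orlicz_conjugate \<psi>) \<Omega> in
      {F \<in> extensional W0.
         (\<forall>g\<in>W0. \<forall>h\<in>W0. (AE x in lebesgue. x \<in> \<Omega> \<longrightarrow> g x = h x) \<longrightarrow> F g = F h) \<and>
         (\<forall>g\<in>W0. \<forall>h\<in>W0. F (\<lambda>x. g x + h x) = F g + F h) \<and>
         (\<forall>g\<in>W0. \<forall>c. F (\<lambda>x. c *\<^sub>R g x) = c *\<^sub>R F g) \<and>
         dual_norm \<psi> \<Omega> F < \<infinity>})"

end

theory Submission
  imports Defs
begin

text \<open>
  The action of \<open>D f\<close> on \<open>g\<close> is the integral of \<open>f\<^sup>* D g\<close>, the star denoting Clifford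
  conjugation. In coordinates this is a finite combination, with constant Clifford coefficients, of the scalar integrals of \<open>f\<^sub>A \<partial>\<^sub>j g\<^sub>B\<close>. Young's inequality
  \<open>s t \<le> \<psi>(s) + \<psi>\<^sup>*(t)\<close>, applied to \<open>s = |f\<^sub>A| / \<alpha>\<close> and \<open>t = |\<partial>\<^sub>j g\<^sub>B| / \<beta>\<close> and integrated, bounds such an
  integral by \<open>\<alpha> \<beta> (M + N)\<close>, where \<open>M\<close> and \<open>N\<close> are the two modulars. Fix \<open>\<alpha>\<close> with \<open>M\<close> finite; for each \<open>\<beta>\<close>
  admissible in the Luxemburg norm of \<open>g\<^sub>B\<close> one has \<open>N \<le> 1\<close>, so the infimum over \<open>\<beta>\<close> bounds the
  integral by \<open>\<alpha> (M + 1)\<close> times the norm of \<open>g\<close>. This is \<open>orlicz_sobolev_pairing\<close>; the sum over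
  all coordinates is \<open>dirac_pairing_bounded\<close>.

  It remains to see that the functional is well defined and linear on classes of functions
  modulo null sets. The weak derivative is a chosen representative, so \<open>D (g + h) = D g + D h\<close>
  holds only almost everywhere, and it rests on the uniqueness of weak derivatives. That is the
  fundamental lemma of the calculus of variations, \<open>fundamental_lemma_calculus_of_variations\<close>:
  a locally integrable function that annihilates all test functions vanishes almost everywhere.
  Dilated copies of \<open>e\<^sup>-\<^sup>1\<^sup>/\<^sup>t\<close> give products of test functions that converge boundedly to the indicator
  of a box, so the function has integral \<open>0\<close> over every box with closure in the
  domain, and boxes generate the Borel sets.

  Linearity also presupposes that the functions of zero trace form a vector space
  (\<open>sobolev_space_0_add\<close>, \<open>sobolev_space_0_scaleR\<close>). Modulars at the scales \<open>\<alpha>\<close> and \<open>\<beta>\<close> control the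
  modular of a sum at the scale \<open>\<alpha> + \<beta>\<close>, and sequences defining two traces may be added.
\<close>

section \<open>Calculus of functions of class \<open>C\<^sup>k\<close>\<close>

lemma partial_eqI:
  assumes "(f has_derivative f') (at x)"
  shows "partial j f x = f' (axis j 1)"
  unfolding partial_def using frechet_derivative_at[OF assms] by simp

lemma partial_add:
  assumes "f differentiable at x" "g differentiable at x"
  shows "partial j (\<lambda>x. f x + g x) x = partial j f x + partial j g x"
  unfolding partial_def[of j f] partial_def[of j g]
  by (rule partial_eqI) (intro has_derivative_add assms[unfolded frechet_derivative_works])

lemma partial_mult:
  assumes "f differentiable at x" "g differentiable at x"
  shows "partial j (\<lambda>x. f x * g x) x = f x * partial j g x + partial j f x * g x"
  unfolding partial_def[of j f] partial_def[of j g]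
  by (rule partial_eqI) (intro has_derivative_mult assms[unfolded frechet_derivative_works])

text \<open>
  Each term of the product rule leaves one factor undifferentiated, so proving a product to be
  of class \<open>C\<^sup>k\<^sup>+\<^sup>1\<close> requires both factors to be of class \<open>C\<^sup>k\<close>.
\<close>

lemma C_k_Suc_imp: "C_k (Suc k) f \<Longrightarrow> C_k k f"
proof (induction k arbitrary: f)
  case 0
  then show ?case
    by (auto intro!: differentiable_imp_continuous_on simp: differentiable_on_def)
next
  case (Suc k)
  then show ?case by (metis C_k.simps(2))
qed

lemma C_k_const: "C_k k (\<lambda>x. c)"
proof (induction k arbitrary: c)
  case (Suc k)
  have "partial j (\<lambda>x. c) = (\<lambda>x. 0)" for j :: 'a
    by (simp add: partial_def fun_eq_iff)
  with Suc show ?case by simp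
qed simp

lemma C_k_add: "C_k k f \<Longrightarrow> C_k k g \<Longrightarrow> C_k k (\<lambda>x. f x + g x)"
proof (induction k arbitrary: f g)
  case (Suc k)
  then have "partial j (\<lambda>x. f x + g x) = (\<lambda>x. partial j f x + partial j g x)" for j
    by (auto simp: partial_add)
  with Suc show ?case by auto
qed (auto intro: continuous_on_add)

lemma C_k_mult: "C_k k f \<Longrightarrow> C_k k g \<Longrightarrow> C_k k (\<lambda>x. f x * g x)"
proof (induction k arbitrary: f g)
  case (Suc k)
  then have "partial j (\<lambda>x. f x * g x) = (\<lambda>x. f x * partial j g x + partial j f x * g x)" for j
    by (auto simp: partial_mult)
  moreover have "C_k k f" "C_k k g" using Suc.prems C_k_Suc_imp by blast+
  ultimately show ?case using Suc by (auto intro!: C_k_add)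
qed (auto intro: continuous_on_mult)

lemma C_k_prod:
  assumes "\<And>i. i \<in> I \<Longrightarrow> C_k k (f i)"
  shows "C_k k (\<lambda>x. \<Prod>i\<in>I. f i x)"
  using assms by (induction I rule: infinite_finite_induct) (auto intro: C_k_const C_k_mult)


section \<open>Smooth bump functions\<close>

text \<open>
  The family \<open>t\<^sup>-\<^sup>k e\<^sup>-\<^sup>1\<^sup>/\<^sup>t\<close>, extended by \<open>0\<close> to \<open>t \<le> 0\<close>. The powers of \<open>1 / t\<close> make its linear span closed
  under differentiation, so all members are smooth by one induction. The member \<open>k = 0\<close> is the
  usual transition function; it takes values in \<open>[0, 1]\<close>.
\<close>

definition flat_exp :: "nat \<Rightarrow> real \<Rightarrow> real" where
  "flat_exp k t = (if 0 < t then inverse t ^ k * exp (- inverse t) else 0)"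

lemma flat_exp_at_right_0: "(flat_exp k \<longlongrightarrow> 0) (at_right 0)"
proof -
  have "((\<lambda>t. inverse t ^ k / exp (inverse t)) \<longlongrightarrow> 0) (at_right (0::real))"
    by (rule filterlim_compose[OF tendsto_power_div_exp_0 filterlim_inverse_at_top_right])
  then show ?thesis
    by (rule Lim_transform_eventually)
      (auto simp: flat_exp_def exp_minus field_simps
        intro!: eventually_mono[OF eventually_at_right_less])
qed

text \<open>
  At \<open>0\<close> the difference quotient is the next member of the family, which tends to \<open>0\<close>.
\<close>

lemma flat_exp_has_derivative:
  "(flat_exp k has_real_derivative flat_exp (k + 2) t - real k * flat_exp (k + 1) t) (at t)"
proof -
  consider "t > 0" | "t < 0" | "t = 0" by linarith
  then show ?thesis
  proof cases
    case 1
    have "((\<lambda>t. inverse t ^ k * exp (- inverse t)) has_real_derivative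
        flat_exp (k + 2) t - real k * flat_exp (k + 1) t) (at t)"
    proof (cases k)
      case 0
      then show ?thesis
        using 1 by (auto intro!: derivative_eq_intros simp: flat_exp_def power2_eq_square)
    next
      case (Suc l)
      have "((\<lambda>t. inverse t ^ Suc l) has_real_derivative
          (1 + real l) * (- (inverse t ^ Suc (Suc 0)) * inverse t ^ l)) (at t)"
        using 1 by (intro DERIV_power_Suc DERIV_inverse) auto
      moreover have "((\<lambda>t. exp (- inverse t)) has_real_derivative
          exp (- inverse t) * inverse t ^ 2) (at t)"
        using 1 by (auto intro!: derivative_eq_intros simp: power2_eq_square)
      ultimately have "((\<lambda>t. inverse t ^ Suc l * exp (- inverse t)) has_real_derivative
          (1 + real l) * (- (inverse t ^ Suc (Suc 0)) * inverse t ^ l) * exp (- inverse t) +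
          exp (- inverse t) * inverse t ^ 2 * inverse t ^ Suc l) (at t)"
        by (rule DERIV_mult)
      then show ?thesis
        unfolding Suc
        by (rule DERIV_cong) (use 1 in \<open>simp add: flat_exp_def power2_eq_square algebra_simps\<close>)
    qed
    then show ?thesis
      by (rule has_field_derivative_transform_within_open[where S = "{0<..}"])
        (use 1 in \<open>auto simp: flat_exp_def\<close>)
  next
    case 2
    have "((\<lambda>t. 0) has_real_derivative flat_exp (k + 2) t - real k * flat_exp (k + 1) t) (at t)"
      using 2 by (auto simp: flat_exp_def)
    then show ?thesis
      by (rule has_field_derivative_transform_within_open[where S = "{..<0}"])
        (use 2 in \<open>auto simp: flat_exp_def\<close>)
  next
    case 3
    have "((\<lambda>y. flat_exp k y / y) \<longlongrightarrow> 0) (at_right 0)"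
      by (rule Lim_transform_eventually[OF flat_exp_at_right_0[of "Suc k"]])
        (auto simp: flat_exp_def field_simps intro!: eventually_mono[OF eventually_at_right_less])
    moreover have "((\<lambda>y. flat_exp k y / y) \<longlongrightarrow> 0) (at_left 0)"
      by (rule Lim_transform_eventually[OF tendsto_const])
        (auto simp: flat_exp_def eventually_at_filter intro!: always_eventually)
    ultimately have "((\<lambda>y. flat_exp k y / y) \<longlongrightarrow> 0) (at 0)"
      by (simp add: filterlim_split_at)
    then show ?thesis
      using 3 by (simp add: has_field_derivative_iff flat_exp_def)
  qed
qed

lemma C_k_flat_exp: "C_k k (\<lambda>x. flat_exp l (c * x $ i + d))"
proof (induction k arbitrary: l)
  case 0
  have "continuous_on UNIV (flat_exp l)"
    by (rule DERIV_continuous_on) (rule flat_exp_has_derivative)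
  moreover have "continuous_on UNIV (\<lambda>x :: real ^ 'a. c * x $ i + d)"
    by (intro continuous_intros)
  ultimately show ?case
    unfolding C_k.simps by (rule continuous_on_compose2) simp
next
  case (Suc k)
  let ?h = "\<lambda>x :: real ^ 'a. c * x $ i + d"
  have D: "((\<lambda>x. flat_exp l (?h x)) has_derivative
      (\<lambda>v. c * v $ i * (flat_exp (l + 2) (?h x) - real l * flat_exp (l + 1) (?h x)))) (at x)" for x
  proof (rule DERIV_compose_FDERIV[OF flat_exp_has_derivative])
    show "(?h has_derivative (\<lambda>v. c * v $ i)) (at x)"
      by (auto intro!: derivative_eq_intros bounded_linear_imp_has_derivative bounded_linear_vec_nth)
  qed
  have eq: "partial j (\<lambda>x. flat_exp l (?h x)) = (\<lambda>x. (c * axis j 1 $ i) *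
      (flat_exp (l + 2) (?h x) + (- real l) * flat_exp (l + 1) (?h x)))" for j
    by (rule ext, subst partial_eqI[OF D]) simp
  have "C_k k (partial j (\<lambda>x. flat_exp l (?h x)))" for j
    unfolding eq by (intro C_k_mult C_k_add C_k_const Suc.IH)
  then show ?case
    unfolding C_k.simps using D by (blast intro: differentiableI)
qed

lemma flat_exp_0_bounds: "0 \<le> flat_exp 0 t" "flat_exp 0 t \<le> 1"
  by (auto simp: flat_exp_def)

text \<open>
  Since \<open>e\<^sup>-\<^sup>1\<^sup>/\<^sup>m\<^sup>t \<rightarrow> 1\<close> for \<open>t > 0\<close>, dilating a single smooth function already approximates the
  indicator of a half line; no smooth step with values exactly \<open>1\<close> has to be constructed.
\<close>

lemma flat_exp_0_dilation_tendsto: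
  "(\<lambda>m. flat_exp 0 (real (Suc m) * t)) \<longlonglongrightarrow> indicator {0<..} t"
proof (cases "0 < t")
  case True
  have "(\<lambda>m. inverse (real (Suc m)) * inverse t) \<longlonglongrightarrow> 0 * inverse t"
    by (intro tendsto_mult tendsto_const LIMSEQ_inverse_real_of_nat)
  from tendsto_exp[OF tendsto_minus[OF this]] True show ?thesis
    by (simp add: flat_exp_def)
next
  case False
  then have "\<not> 0 < real (Suc m) * t" for m
    by (metis of_nat_0_less_iff zero_less_Suc zero_less_mult_pos)
  with False show ?thesis by (simp add: flat_exp_def)
qed

definition box_bump :: "nat \<Rightarrow> real ^ 'n \<Rightarrow> real ^ 'n \<Rightarrow> real ^ 'n::finite \<Rightarrow> real" where
  "box_bump m a b = (\<lambda>x.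
     (\<Prod>i\<in>UNIV. flat_exp 0 (real (Suc m) * (x $ i - a $ i)) * flat_exp 0 (real (Suc m) * (b $ i
         - x $ i))))"

lemma C_k_box_bump: "C_k k (box_bump m a b)"
  unfolding box_bump_def
proof (rule C_k_prod)
  fix i
  define M where "M = real (Suc m)"
  have "C_k k (\<lambda>x. flat_exp 0 (M * x $ i + (- M * a $ i)) * flat_exp 0 (- M * x $ i + M * b $ i))"
    by (intro C_k_mult C_k_flat_exp)
  moreover have "M * x $ i + (- M * a $ i) = M * (x $ i - a $ i)"
    "- M * x $ i + M * b $ i = M * (b $ i - x $ i)" for x
    by (simp_all add: right_diff_distrib)
  ultimately show "C_k k (\<lambda>x. flat_exp 0 (real (Suc m) * (x $ i - a $ i)) *
      flat_exp 0 (real (Suc m) * (b $ i - x $ i)))"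
    unfolding M_def[symmetric] by simp
qed

lemma box_bump_bounds: "0 \<le> box_bump m a b x" "box_bump m a b x \<le> 1"
proof -
  have nonneg: "0 \<le> flat_exp 0 s * flat_exp 0 t" for s t
    by (rule mult_nonneg_nonneg; rule flat_exp_0_bounds)
  moreover have "flat_exp 0 s * flat_exp 0 t \<le> 1" for s t
    by (rule mult_le_one; rule flat_exp_0_bounds)
  ultimately show "0 \<le> box_bump m a b x" "box_bump m a b x \<le> 1"
    unfolding box_bump_def by - (rule prod_nonneg, assumption, rule prod_le_1, rule conjI)
qed

text \<open>
  Pointwise convergence everywhere, not only almost everywhere: both sides vanish off the
  open box.
\<close>

lemma box_bump_tendsto: "(\<lambda>m. box_bump m a b x) \<longlonglongrightarrow> indicator (box a b) x"
proof -
  have "(\<lambda>m. box_bump m a b x) \<longlonglongrightarrow>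
      (\<Prod>i\<in>UNIV. indicator {0<..} (x $ i - a $ i) * indicator {0<..} (b $ i - x $ i))"
    unfolding box_bump_def by (intro tendsto_prod tendsto_mult flat_exp_0_dilation_tendsto)
  moreover have "(\<Prod>i\<in>UNIV. indicator {0<..} (x $ i - a $ i) * indicator {0<..} (b $ i - x $ i)) =
      (indicator (box a b) x :: real)"
  proof (cases "x \<in> box a b")
    case True
    then show ?thesis by (auto simp: mem_box_cart)
  next
    case False
    then obtain i where "\<not> (a $ i < x $ i \<and> x $ i < b $ i)"
      by (auto simp: mem_box_cart)
    then have "indicator {0<..} (x $ i - a $ i) * indicator {0<..} (b $ i - x $ i) = (0::real)"
      by (auto simp: indicator_def)
    then have "(\<Prod>i\<in>UNIV. indicator {0<..} (x $ i - a $ i) * indicator {0<..} (b $ i - x $ i)) =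
        (0::real)"
      by (intro prod_zero) auto
    with False show ?thesis by simp
  qed
  ultimately show ?thesis by simp
qed

lemma box_bump_outside:
  assumes "x \<notin> box a b"
  shows "box_bump m a b x = 0"
proof -
  obtain i where "\<not> 0 < x $ i - a $ i \<or> \<not> 0 < b $ i - x $ i"
    using assms by (auto simp: mem_box_cart)
  then have "flat_exp 0 (real (Suc m) * (x $ i - a $ i)) * flat_exp 0 (real (Suc m) * (b $ i
      - x $ i)) = 0"
    by (auto simp: flat_exp_def zero_less_mult_iff)
  then show ?thesis
    unfolding box_bump_def by (intro prod_zero) auto
qed

lemma box_bump_test_function:
  assumes "cbox a b \<subseteq> \<Omega>"
  shows "box_bump m a b \<in> test_functions \<Omega>"
proof -
  have "{x. box_bump m a b x \<noteq> 0} \<subseteq> cbox a b"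
    using box_bump_outside box_subset_cbox by blast
  then have "closure {x. box_bump m a b x \<noteq> 0} \<subseteq> cbox a b"
    by (rule closure_minimal[OF _ closed_cbox])
  moreover from this have "compact (closure {x. box_bump m a b x \<noteq> 0})"
    by (intro compact_eq_bounded_closed[THEN iffD2] conjI bounded_subset[OF bounded_cbox] closed_closure)
  ultimately show ?thesis
    using assms C_k_box_bump unfolding test_functions_def by blast
qed

section \<open>The fundamental lemma of the calculus of variations\<close>

lemma C_k_continuous: "C_k k f \<Longrightarrow> continuous_on UNIV f"
  by (induction k) (use C_k_Suc_imp C_k.simps(1) in blast)+

lemma C_k_borel_lebesgue:
  assumes "C_k k f"
  shows "f \<in> borel_measurable lebesgue"
proof -
  have "f \<in> borel_measurable borel"
    by (rule borel_measurable_continuous_onI[OF C_k_continuous[OF assms]])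
  then show ?thesis by (intro measurable_completion) simp
qed

text \<open>
  Local integrability gives measurability on compact sets only; an open set is a countable
  union of closed boxes.
\<close>

lemma locally_integrable_set_borel_measurable:
  assumes "open \<Omega>" "locally_integrable \<Omega> u"
  shows "set_borel_measurable lebesgue \<Omega> u"
proof -
  obtain \<D> where D: "countable \<D>" "\<D> \<subseteq> Pow \<Omega>" "\<And>X. X \<in> \<D> \<Longrightarrow> \<exists>a b. X = cbox a b" "\<Union>\<D> = \<Omega>"
    using open_countable_Union_open_cbox[OF assms(1)] by blast
  have K: "compact K" "K \<subseteq> \<Omega>" "K \<in> sets lebesgue" if "K \<in> \<D>" for K
    using D(2) D(3)[OF that] that by auto
  have [measurable]: "\<Omega> \<in> sets lebesgue" using assms(1) by auto
  have piece: "(\<lambda>x. indicat_real \<Omega> x *\<^sub>R u x) \<in> borel_measurable (restrict_space lebesgue K)"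
    if K': "K \<in> insert (- \<Omega>) \<D>" for K
  proof (cases "K \<in> \<D>")
    case True
    from K[OF True] assms(2) have "set_integrable lebesgue K u"
      by (auto simp: locally_integrable_def)
    then have "u \<in> borel_measurable (restrict_space lebesgue K)"
      using K(3)[OF True]
      by (subst borel_measurable_restrict_space_iff)
        (auto simp: set_integrable_def dest: borel_measurable_integrable)
    then show ?thesis
      by (rule measurable_cong[THEN iffD1, rotated])
        (use K(2)[OF True] in \<open>auto simp: space_restrict_space\<close>)
  next
    case False
    with K' have "K = - \<Omega>" by simp
    then show ?thesis
      by (subst measurable_cong[where g = "\<lambda>x. 0"]) (auto simp: space_restrict_space)
  qed
  have pieces: "K \<in> sets lebesgue" if "K \<in> insert (- \<Omega>) \<D>" for K
    using that K(3) assms(1) by auto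
  show ?thesis
    unfolding set_borel_measurable_def
    by (rule measurable_piecewise_restrict[where C = "insert (- \<Omega>) \<D>", OF _ _ _ piece])
      (use D(1,4) pieces in auto)
qed


text \<open>
  The bumps \<^const>\<open>box_bump\<close> are dominated by the indicator of the box, so their limit may be
  inserted into the orthogonality relation in place of a test function.
\<close>

lemma set_integral_box_eq_0:
  fixes w :: "real ^ 'n::finite \<Rightarrow> real"
  assumes \<Omega>: "open \<Omega>" "locally_integrable \<Omega> w" "cbox a b \<subseteq> \<Omega>"
    and orth: "\<And>\<phi>. \<phi> \<in> test_functions \<Omega> \<Longrightarrow> (LINT x:\<Omega>|lebesgue. w x * \<phi> x) = 0"
  shows "(LINT x:box a b|lebesgue. w x) = 0"
proof -
  have int: "set_integrable lebesgue (cbox a b) w"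
    using \<Omega> by (auto simp: locally_integrable_def)
  have [measurable]: "(\<lambda>x. indicat_real \<Omega> x * w x) \<in> borel_measurable lebesgue"
    using locally_integrable_set_borel_measurable[OF \<Omega>(1,2)] by (simp add: set_borel_measurable_def)
  have [measurable]: "box_bump m a b \<in> borel_measurable lebesgue" for m
    by (rule C_k_borel_lebesgue[OF C_k_box_bump[of 0]])
  have [measurable]: "box a b \<in> sets lebesgue" by simp
  have lim: "(\<lambda>m. LINT x|lebesgue. (indicator \<Omega> x * w x) * box_bump m a b x)
      \<longlonglongrightarrow> (LINT x|lebesgue. (indicator \<Omega> x * w x) * indicator (box a b) x)"
  proof (rule integral_dominated_convergence[where w = "\<lambda>x. \<bar>indicator (cbox a b) x *\<^sub>R w x\<bar>"])
    show "integrable lebesgue (\<lambda>x. \<bar>indicator (cbox a b) x *\<^sub>R w x\<bar>)"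
      using int by (simp add: set_integrable_def)
    show "AE x in lebesgue. (\<lambda>m. (indicator \<Omega> x * w x) * box_bump m a b x)
        \<longlonglongrightarrow> (indicator \<Omega> x * w x) * indicator (box a b) x"
      by (intro AE_I2 tendsto_mult tendsto_const box_bump_tendsto)
    show "AE x in lebesgue. norm ((indicator \<Omega> x * w x) * box_bump m a b x)
        \<le> \<bar>indicator (cbox a b) x *\<^sub>R w x\<bar>" for m
    proof (rule AE_I2)
      fix x
      show "norm ((indicator \<Omega> x * w x) * box_bump m a b x) \<le> \<bar>indicator (cbox a b) x *\<^sub>R w x\<bar>"
      proof (cases "x \<in> box a b")
        case True
        then have "x \<in> cbox a b" "x \<in> \<Omega>"
          using \<Omega>(3) box_subset_cbox by auto
        then show ?thesis
          using box_bump_bounds[of m a b x] by (simp add: abs_mult mult_left_le)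
      next
        case False
        then show ?thesis by (simp add: box_bump_outside)
      qed
    qed
  qed measurable
  have "(LINT x|lebesgue. (indicator \<Omega> x * w x) * box_bump m a b x) = 0" for m
    using orth[OF box_bump_test_function[OF \<Omega>(3)], of m]
    by (simp add: set_lebesgue_integral_def mult.assoc)
  with lim have "(LINT x|lebesgue. (indicator \<Omega> x * w x) * indicator (box a b) x) = 0"
    by (simp add: LIMSEQ_const_iff)
  moreover have "(indicator \<Omega> x * w x) * indicator (box a b) x = indicator (box a b) x *\<^sub>R w x" for x
    using \<Omega>(3) box_subset_cbox[of a b] by (auto simp: indicator_def)
  ultimately show ?thesis
    by (simp add: set_lebesgue_integral_def)
qed

text \<open>
  The sets over which \<open>f\<close> has integral \<open>0\<close> form a Dynkin system, and the boxes are an intersection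
  stable generator of the Borel sets. A Borel representative of \<open>f\<close> then has vanishing integral
  over every Borel set.
\<close>

lemma AE_eq_0_if_box_integrals_eq_0:
  fixes f :: "real ^ 'n::finite \<Rightarrow> real"
  assumes f: "integrable lebesgue f" "(LINT x|lebesgue. f x) = 0"
    and box: "\<And>c d. (LINT x:box c d|lebesgue. f x) = 0"
  shows "AE x in lebesgue. f x = 0"
proof -
  have zero: "(LINT x:A|lebesgue. f x) = 0" if "A \<in> sets borel" for A
  proof -
    have int: "set_integrable lebesgue B f" if "B \<in> sets borel" for B
      unfolding set_integrable_def using that f(1) by (intro integrable_mult_indicator) auto
    have A: "A \<in> sigma_sets UNIV (range (\<lambda>(a, b). box a b))"
      using that unfolding borel_eq_box by simp
    have sub: "range (\<lambda>(a, b). box a b :: (real ^ 'n) set) \<subseteq> Pow UNIV" by simp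
    have stable: "Int_stable (range (\<lambda>(a, b). box a b :: (real ^ 'n) set))"
      by (auto simp: Int_stable_def box_Int_box)
    show ?thesis
      using stable sub A
    proof (induction rule: sigma_sets_induct_disjoint)
      case (basic A)
      then show ?case using box by auto
    next
      case empty
      then show ?case by (simp add: set_lebesgue_integral_def)
    next
      case (compl A)
      then have [measurable]: "A \<in> sets borel"
        by (simp add: borel_eq_box)
      have "(LINT x:A \<union> (UNIV - A)|lebesgue. f x) =
          (LINT x:A|lebesgue. f x) + (LINT x:UNIV - A|lebesgue. f x)"
        by (rule set_integral_Un) (auto intro!: int)
      moreover have "A \<union> (UNIV - A) = UNIV" by auto
      ultimately show ?case
        using compl f(2) by (simp add: set_lebesgue_integral_def)
    next
      case (union A)
      then have A: "A i \<in> sets borel" for i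
        by (auto simp: borel_eq_box)
      have "(LINT x:(\<Union>i. A i)|lebesgue. f x) = (\<Sum>i. LINT x:A i|lebesgue. f x)"
      proof (rule lebesgue_integral_countable_add)
        show "set_integrable lebesgue (\<Union>i. A i) f" using A by (intro int) auto
      qed (use A union(1) in \<open>auto simp: disjoint_family_on_def\<close>)
      with union show ?case by simp
    qed
  qed
  obtain g where g[measurable]: "g \<in> borel_measurable lborel" and fg: "AE x in lborel. f x = g x"
    using completion_ex_borel_measurable_real borel_measurable_integrable[OF f(1)] by blast
  have fg': "AE x in lebesgue. f x = g x" by (rule AE_completion[OF fg])
  have g_int: "integrable lborel g"
  proof -
    have "integrable lebesgue g"
      using f(1) by (rule integrable_cong_AE_imp) (use fg' in \<open>auto intro: measurable_completion\<close>)
    then show ?thesis by (simp add: integrable_completion)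
  qed
  have "AE x in lborel. g x = 0"
  proof (rule sigma_finite_measure.density_zero[OF sigma_finite_lborel g_int])
    fix A :: "(real ^ 'n) set" assume "A \<in> sets lborel"
    then have A[measurable]: "A \<in> sets borel" by simp
    have "(LINT x:A|lborel. g x) = (LINT x:A|lebesgue. g x)"
      unfolding set_lebesgue_integral_def by (intro integral_completion[symmetric]) measurable
    also have "\<dots> = (LINT x:A|lebesgue. f x)"
      unfolding set_lebesgue_integral_def
    proof (rule integral_cong_AE)
      show "(\<lambda>x. indicat_real A x *\<^sub>R g x) \<in> borel_measurable lebesgue"
        by (intro measurable_completion) measurable
      show "(\<lambda>x. indicat_real A x *\<^sub>R f x) \<in> borel_measurable lebesgue"
        using A by (intro borel_measurable_integrable integrable_mult_indicator f(1)) auto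
    qed (use fg' in auto)
    finally show "(LINT x:A|lborel. g x) = 0" using zero[OF A] by simp
  qed
  with fg have "AE x in lborel. f x = 0" by eventually_elim simp
  then show ?thesis by (rule AE_completion)
qed

text \<open>
  Locally, the function \<open>w\<close> restricted to a box has vanishing integral over every box, because
  the intersection of two boxes is a box. Countably many boxes cover the domain.
\<close>

lemma fundamental_lemma_calculus_of_variations:
  fixes w :: "real ^ 'n::finite \<Rightarrow> real"
  assumes \<Omega>: "open \<Omega>" "locally_integrable \<Omega> w"
    and orth: "\<And>\<phi>. \<phi> \<in> test_functions \<Omega> \<Longrightarrow> (LINT x:\<Omega>|lebesgue. w x * \<phi> x) = 0"
  shows "AE x in lebesgue. x \<in> \<Omega> \<longrightarrow> w x = 0"
proof -
  have on_cbox: "AE x in lebesgue. x \<in> cbox a b \<longrightarrow> w x = 0" if ab: "cbox a b \<subseteq> \<Omega>" for a b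
  proof -
    have int: "integrable lebesgue (\<lambda>x. indicator (box a b) x * w x)"
    proof -
      have "set_integrable lebesgue (cbox a b) w"
        using \<Omega>(2) ab by (auto simp: locally_integrable_def)
      then have "set_integrable lebesgue (box a b) w"
        by (rule set_integrable_subset) (auto simp: box_subset_cbox)
      then show ?thesis by (simp add: set_integrable_def)
    qed
    have "AE x in lebesgue. indicator (box a b) x * w x = 0"
    proof (rule AE_eq_0_if_box_integrals_eq_0[OF int])
      show "(LINT x|lebesgue. indicator (box a b) x * w x) = 0"
        using set_integral_box_eq_0[OF \<Omega> ab orth] by (simp add: set_lebesgue_integral_def)
      fix c d :: "real ^ 'n"
      define l u where "l = (\<Sum>i\<in>Basis. max (c \<bullet> i) (a \<bullet> i) *\<^sub>R i)"
        and "u = (\<Sum>i\<in>Basis. min (d \<bullet> i) (b \<bullet> i) *\<^sub>R i)"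
      have eq: "box c d \<inter> box a b = box l u" "cbox c d \<inter> cbox a b = cbox l u"
        by (simp_all add: box_Int_box Int_interval l_def u_def)
      have "(LINT x:box l u|lebesgue. w x) = 0"
        using set_integral_box_eq_0[OF \<Omega> _ orth] eq(2) ab by blast
      then show "(LINT x:box c d|lebesgue. indicator (box a b) x * w x) = 0"
        by (simp add: set_lebesgue_integral_def flip: eq(1) mult.assoc indicator_inter_arith)
    qed
    moreover have "AE x in lebesgue. x \<notin> cbox a b - box a b"
      by (rule AE_not_in) (simp flip: negligible_iff_null_sets add: negligible_frontier_interval)
    ultimately show ?thesis
      by eventually_elim auto
  qed
  obtain \<D> where D: "countable \<D>" "\<D> \<subseteq> Pow \<Omega>" "\<And>X. X \<in> \<D> \<Longrightarrow> \<exists>a b. X = cbox a b" "\<Union>\<D> = \<Omega>"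
    using open_countable_Union_open_cbox[OF \<Omega>(1)] by blast
  have "AE x in lebesgue. \<forall>X\<in>\<D>. x \<in> X \<longrightarrow> w x = 0"
    using D(2,3) on_cbox by (intro AE_ball_countable'[OF _ D(1)]) blast
  then show ?thesis
    by eventually_elim (use D(4) in blast)
qed

section \<open>Weak derivatives\<close>

lemma locally_integrable_add:
  "locally_integrable \<Omega> u \<Longrightarrow> locally_integrable \<Omega> v \<Longrightarrow> locally_integrable \<Omega> (\<lambda>x. u x + v x)"
  by (simp add: locally_integrable_def set_integral_add(1))

lemma locally_integrable_cmult:
  "locally_integrable \<Omega> u \<Longrightarrow> locally_integrable \<Omega> (\<lambda>x. c * u x)"
  by (simp add: locally_integrable_def)

lemma set_integrable_mult_continuous:
  fixes u \<phi> :: "real ^ 'n::finite \<Rightarrow> real"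
  assumes u: "locally_integrable \<Omega> u"
    and \<phi>: "continuous_on UNIV \<phi>"
    and K: "compact K" "K \<subseteq> \<Omega>" "\<And>x. x \<notin> K \<Longrightarrow> \<phi> x = 0"
  shows "set_integrable lebesgue \<Omega> (\<lambda>x. u x * \<phi> x)"
proof -
  have int: "set_integrable lebesgue K u"
    using u K by (simp add: locally_integrable_def)
  have meas: "\<phi> \<in> borel_measurable lebesgue"
    by (intro measurable_completion) (simp add: borel_measurable_continuous_onI \<phi>)
  have "compact (\<phi> ` K)"
    by (rule compact_continuous_image[OF continuous_on_subset[OF \<phi>] K(1)]) simp
  then obtain B where B: "\<And>x. x \<in> K \<Longrightarrow> \<bar>\<phi> x\<bar> \<le> B"
    using compact_imp_bounded[of "\<phi> ` K"] by (auto simp: bounded_iff)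
  have "integrable lebesgue (\<lambda>x. (indicator K x *\<^sub>R u x) * \<phi> x)"
  proof (rule Bochner_Integration.integrable_bound)
    show "integrable lebesgue (\<lambda>x. \<bar>B\<bar> * (indicator K x *\<^sub>R u x))"
      using int by (simp add: set_integrable_def)
    show "(\<lambda>x. (indicator K x *\<^sub>R u x) * \<phi> x) \<in> borel_measurable lebesgue"
      using int meas by (auto simp: set_integrable_def dest: borel_measurable_integrable)
    show "AE x in lebesgue. norm ((indicator K x *\<^sub>R u x) * \<phi> x)
        \<le> norm (\<bar>B\<bar> * (indicator K x *\<^sub>R u x))"
    proof (rule AE_I2)
      fix x
      show "norm ((indicator K x *\<^sub>R u x) * \<phi> x) \<le> norm (\<bar>B\<bar> * (indicator K x *\<^sub>R u x))"
        using B[of x] by (cases "x \<in> K")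
            (auto simp: abs_mult mult.commute intro!: mult_left_mono mult_right_mono
            order_trans[OF B abs_ge_self])
    qed
  qed
  moreover have "(indicator K x *\<^sub>R u x) * \<phi> x = indicator \<Omega> x *\<^sub>R (u x * \<phi> x)" for x
    using K(2) K(3)[of x] by (auto simp: indicator_def)
  ultimately show ?thesis
    unfolding set_integrable_def by (simp only:)
qed

text \<open>
  The complement of the closed support is open, so the function vanishes near the point.
\<close>

lemma partial_outside_support:
  assumes "x \<notin> closure {x. \<phi> x \<noteq> 0}"
  shows "partial j \<phi> x = 0"
proof -
  have "((\<lambda>x. 0) has_derivative (\<lambda>v. 0)) (at x)" by simp
  then have "(\<phi> has_derivative (\<lambda>v. 0)) (at x)"
    by (rule has_derivative_transform_within_open[where s = "- closure {x. \<phi> x \<noteq> 0}"])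
      (use assms closure_subset[of "{x. \<phi> x \<noteq> 0}"] in auto)
  then show ?thesis by (rule partial_eqI)
qed

lemma test_function_integrable:
  assumes "locally_integrable \<Omega> u" "\<phi> \<in> test_functions \<Omega>"
  shows "set_integrable lebesgue \<Omega> (\<lambda>x. u x * \<phi> x)"
    and "set_integrable lebesgue \<Omega> (\<lambda>x. u x * partial j \<phi> x)"
proof -
  have C: "C_k k \<phi>" for k
    using assms(2) by (simp add: test_functions_def)
  have supp: "compact (closure {x. \<phi> x \<noteq> 0})" "closure {x. \<phi> x \<noteq> 0} \<subseteq> \<Omega>"
    using assms(2) by (simp_all add: test_functions_def)
  have zero: "\<phi> x = 0" if "x \<notin> closure {x. \<phi> x \<noteq> 0}" for x
    using that closure_subset[of "{x. \<phi> x \<noteq> 0}"] by auto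
  show "set_integrable lebesgue \<Omega> (\<lambda>x. u x * \<phi> x)"
    by (rule set_integrable_mult_continuous[OF assms(1) C_k_continuous[OF C[of 0]] supp zero])
  have cont: "continuous_on UNIV (partial j \<phi>)"
    using C[of "Suc 0"] by simp
  show "set_integrable lebesgue \<Omega> (\<lambda>x. u x * partial j \<phi> x)"
    by (rule set_integrable_mult_continuous[OF assms(1) cont supp partial_outside_support])
qed

lemma has_weak_partial_add:
  assumes "has_weak_partial \<Omega> j u v" "has_weak_partial \<Omega> j u' v'"
  shows "has_weak_partial \<Omega> j (\<lambda>x. u x + u' x) (\<lambda>x. v x + v' x)"
proof -
  have loc: "locally_integrable \<Omega> u" "locally_integrable \<Omega> v"
    "locally_integrable \<Omega> u'" "locally_integrable \<Omega> v'"
    using assms by (simp_all add: has_weak_partial_def)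
  have "(LINT x:\<Omega>|lebesgue. (u x + u' x) * partial j \<phi> x) =
      - (LINT x:\<Omega>|lebesgue. (v x + v' x) * \<phi> x)" if "\<phi> \<in> test_functions \<Omega>" for \<phi>
  proof -
    have "(LINT x:\<Omega>|lebesgue. (u x + u' x) * partial j \<phi> x) =
        (LINT x:\<Omega>|lebesgue. u x * partial j \<phi> x) + (LINT x:\<Omega>|lebesgue. u' x * partial j \<phi> x)"
      unfolding distrib_right by (intro set_integral_add(2) test_function_integrable loc that)
    also have "\<dots> = - ((LINT x:\<Omega>|lebesgue. v x * \<phi> x) + (LINT x:\<Omega>|lebesgue. v' x * \<phi> x))"
      using assms that by (simp add: has_weak_partial_def)
    also have "\<dots> = - (LINT x:\<Omega>|lebesgue. (v x + v' x) * \<phi> x)"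
      unfolding distrib_right
      by (intro arg_cong[where f = uminus] set_integral_add(2)[symmetric]
          test_function_integrable loc that)
    finally show ?thesis .
  qed
  with loc show ?thesis
    by (simp add: has_weak_partial_def locally_integrable_add)
qed

lemma has_weak_partial_cmult:
  assumes "has_weak_partial \<Omega> j u v"
  shows "has_weak_partial \<Omega> j (\<lambda>x. c * u x) (\<lambda>x. c * v x)"
  using assms by (simp add: has_weak_partial_def locally_integrable_cmult mult.assoc)

text \<open>
  The difference of two weak derivatives is orthogonal to all test functions.
\<close>

lemma has_weak_partial_unique:
  assumes "open \<Omega>" "has_weak_partial \<Omega> j u v" "has_weak_partial \<Omega> j u v'"
  shows "AE x in lebesgue. x \<in> \<Omega> \<longrightarrow> v x = v' x"
proof -
  have loc: "locally_integrable \<Omega> v" "locally_integrable \<Omega> v'"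
    using assms by (auto simp: has_weak_partial_def)
  have "AE x in lebesgue. x \<in> \<Omega> \<longrightarrow> v x + (- 1) * v' x = 0"
  proof (rule fundamental_lemma_calculus_of_variations[OF assms(1)])
    show "locally_integrable \<Omega> (\<lambda>x. v x + (- 1) * v' x)"
      by (intro locally_integrable_add locally_integrable_cmult loc)
    fix \<phi> assume \<phi>: "\<phi> \<in> test_functions \<Omega>"
    have "(LINT x:\<Omega>|lebesgue. (v x + (- 1) * v' x) * \<phi> x) =
        (LINT x:\<Omega>|lebesgue. v x * \<phi> x - v' x * \<phi> x)"
      by (simp add: left_diff_distrib)
    also have "\<dots> = (LINT x:\<Omega>|lebesgue. v x * \<phi> x) - (LINT x:\<Omega>|lebesgue. v' x * \<phi> x)"
      by (intro set_integral_diff(2) test_function_integrable loc \<phi>)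
    also have "\<dots> = 0"
      using assms(2,3) \<phi> by (simp add: has_weak_partial_def)
    finally show "(LINT x:\<Omega>|lebesgue. (v x + (- 1) * v' x) * \<phi> x) = 0" .
  qed
  then show ?thesis by eventually_elim simp
qed

lemma has_weak_partial_weak_partial:
  "has_weak_partial \<Omega> j u v \<Longrightarrow> has_weak_partial \<Omega> j u (weak_partial \<Omega> j u)"
  unfolding weak_partial_def by (rule someI[where P = "has_weak_partial \<Omega> j u"])

text \<open>
  The function \<^const>\<open>weak_partial\<close> is an arbitrary choice of representative, made separately for
  each function. Uniqueness almost everywhere is what relates the choices for \<open>u\<close>, \<open>u'\<close> and
  \<open>u + u'\<close>, and hence what makes the Dirac operator linear up to null sets.
\<close>

lemma weak_partial_eq:
  assumes "open \<Omega>" "has_weak_partial \<Omega> j u v"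
  shows "AE x in lebesgue. x \<in> \<Omega> \<longrightarrow> weak_partial \<Omega> j u x = v x"
  using assms has_weak_partial_unique has_weak_partial_weak_partial by blast

lemma weak_partial_add:
  assumes "open \<Omega>" "has_weak_partial \<Omega> j u v" "has_weak_partial \<Omega> j u' v'"
  shows "AE x in lebesgue. x \<in> \<Omega> \<longrightarrow>
    weak_partial \<Omega> j (\<lambda>x. u x + u' x) x = weak_partial \<Omega> j u x + weak_partial \<Omega> j u' x"
  using weak_partial_eq[OF assms(1) has_weak_partial_add] has_weak_partial_weak_partial assms(2,3)
  by blast

lemma weak_partial_cmult:
  assumes "open \<Omega>" "has_weak_partial \<Omega> j u v"
  shows "AE x in lebesgue. x \<in> \<Omega> \<longrightarrow> weak_partial \<Omega> j (\<lambda>x. c * u x) x = c * weak_partial \<Omega> j u x"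
  using weak_partial_eq[OF assms(1) has_weak_partial_cmult] has_weak_partial_weak_partial assms(2)
  by blast

text \<open>
  All subsets of the exceptional null set are measurable, so the two preimages of a Borel set
  differ by measurable sets.
\<close>

lemma (in complete_measure) borel_measurable_if_AE_eq:
  assumes f: "f \<in> borel_measurable M" and eq: "AE x in M. f x = g x"
  shows "g \<in> borel_measurable M"
proof (rule measurableI)
  fix B :: "'b set" assume B: "B \<in> sets borel"
  from eq obtain N where N: "N \<in> null_sets M" "{x \<in> space M. f x \<noteq> g x} \<subseteq> N"
    by (auto elim: AE_E3 simp: eventually_ae_filter)
  have eq: "g -` B \<inter> space M = (f -` B \<inter> space M - N) \<union> (g -` B \<inter> space M \<inter> N)"
    using N(2) by auto
  have "g -` B \<inter> space M \<inter> N \<in> sets M"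
    by (rule complete[OF _ N(1)]) auto
  moreover have "f -` B \<inter> space M - N \<in> sets M"
    using measurable_sets[OF f B] N(1) by auto
  ultimately show "g -` B \<inter> space M \<in> sets M"
    by (subst eq) (rule sets.Un)
qed simp

lemma set_integral_cong_AE_lebesgue:
  fixes u v :: "'a::euclidean_space \<Rightarrow> 'b::{banach, second_countable_topology}"
  assumes "AE x in lebesgue. x \<in> S \<longrightarrow> u x = v x"
  shows "set_integrable lebesgue S u \<longleftrightarrow> set_integrable lebesgue S v"
    and "(LINT x:S|lebesgue. u x) = (LINT x:S|lebesgue. v x)"
proof -
  let ?u = "\<lambda>x. indicator S x *\<^sub>R u x" and ?v = "\<lambda>x. indicator S x *\<^sub>R v x"
  have AE: "AE x in lebesgue. ?u x = ?v x"
    using assms by eventually_elim (auto simp: indicator_def)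
  then have AE': "AE x in lebesgue. ?v x = ?u x" by eventually_elim (rule sym)
  show iff: "set_integrable lebesgue S u \<longleftrightarrow> set_integrable lebesgue S v"
    unfolding set_integrable_def
  proof
    assume u: "integrable lebesgue ?u"
    show "integrable lebesgue ?v"
      by (rule integrable_cong_AE_imp[OF u _ AE], rule completion.borel_measurable_if_AE_eq[OF _ AE])
        (rule borel_measurable_integrable[OF u])
  next
    assume v: "integrable lebesgue ?v"
    show "integrable lebesgue ?u"
      by (rule integrable_cong_AE_imp[OF v _ AE'], rule completion.borel_measurable_if_AE_eq[OF _ AE'])
        (rule borel_measurable_integrable[OF v])
  qed
  show "(LINT x:S|lebesgue. u x) = (LINT x:S|lebesgue. v x)"
  proof (cases "set_integrable lebesgue S u")
    case True
    with iff have "?u \<in> borel_measurable lebesgue" "?v \<in> borel_measurable lebesgue"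
      by (simp_all add: set_integrable_def borel_measurable_integrable)
    then show ?thesis
      unfolding set_lebesgue_integral_def using AE by (intro integral_cong_AE)
  next
    case False
    with iff show ?thesis
      by (simp add: set_integrable_def set_lebesgue_integral_def not_integrable_integral_eq)
  qed
qed

lemma has_weak_partial_cong_AE:
  assumes "AE x in lebesgue. x \<in> \<Omega> \<longrightarrow> u x = u' x"
  shows "has_weak_partial \<Omega> j u v \<longleftrightarrow> has_weak_partial \<Omega> j u' v"
proof -
  have "locally_integrable \<Omega> u \<longleftrightarrow> locally_integrable \<Omega> u'"
    unfolding locally_integrable_def
  proof (intro all_cong1 imp_cong refl set_integral_cong_AE_lebesgue(1))
    show "AE x in lebesgue. x \<in> K \<longrightarrow> u x = u' x" if "compact K \<and> K \<subseteq> \<Omega>" for K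
      using assms by eventually_elim (use that in auto)
  qed
  moreover have "(LINT x:\<Omega>|lebesgue. u x * \<phi> x) = (LINT x:\<Omega>|lebesgue. u' x * \<phi> x)" for \<phi>
    by (rule set_integral_cong_AE_lebesgue(2)) (use assms in \<open>eventually_elim, auto\<close>)
  ultimately show ?thesis by (simp add: has_weak_partial_def)
qed

text \<open>
  An equality of functions, and not just almost everywhere: the two functions have the same
  weak derivatives, hence the choice among these is the same.
\<close>

lemma weak_partial_cong_AE:
  assumes "AE x in lebesgue. x \<in> \<Omega> \<longrightarrow> u x = u' x"
  shows "weak_partial \<Omega> j u = weak_partial \<Omega> j u'"
  using has_weak_partial_cong_AE[OF assms] by (simp add: weak_partial_def)

section \<open>Modulars of sums and multiples\<close>

lemma orlicz_conjugate_mono: "mono (orlicz_conjugate \<psi>)"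
  unfolding orlicz_conjugate_def
  by (intro monoI SUP_subset_mono order_refl ennreal_leI diff_right_mono mult_left_mono) auto

text \<open>
  A supremum of continuous functions is lower semicontinuous.
\<close>

lemma orlicz_conjugate_borel [measurable]: "orlicz_conjugate \<psi> \<in> borel_measurable borel"
proof (rule borel_measurableI_greater)
  fix y
  have "open (\<Union>s\<in>{0..}. {t. y < ennreal (s * t - \<psi> s)})"
    by (intro open_UN ballI open_Collect_less continuous_on_ennreal continuous_intros)
  moreover have "{t \<in> space borel. y < orlicz_conjugate \<psi> t} = (\<Union>s\<in>{0..}. {t. y < ennreal (s * t
      - \<psi> s)})"
    by (auto simp: orlicz_conjugate_def less_SUP_iff)
  ultimately show "{t \<in> space borel. y < orlicz_conjugate \<psi> t} \<in> sets borel"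
    by (simp only: borel_open)
qed

lemma set_borel_measurable_diff:
  fixes p q :: "'a \<Rightarrow> real"
  shows "set_borel_measurable M S p \<Longrightarrow> set_borel_measurable M S q \<Longrightarrow>
    set_borel_measurable M S (\<lambda>x. p x - q x)"
  by (simp add: set_borel_measurable_def right_diff_distrib)

lemma set_borel_measurable_compose_indicator:
  fixes u :: "'a \<Rightarrow> real" and \<Phi> :: "real \<Rightarrow> ennreal"
  assumes [measurable]: "S \<in> sets M" "\<Phi> \<in> borel_measurable borel"
    and u: "set_borel_measurable M S u"
  shows "(\<lambda>x. \<Phi> (u x) * indicator S x) \<in> borel_measurable M"
proof -
  have [measurable]: "(\<lambda>x. indicator S x * u x) \<in> borel_measurable M"
    using u by (simp add: set_borel_measurable_def)
  have "(\<lambda>x. \<Phi> (indicator S x * u x) * indicator S x) \<in> borel_measurable M"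
    by measurable
  also have "(\<lambda>x. \<Phi> (indicator S x * u x) * indicator S x) = (\<lambda>x. \<Phi> (u x) * indicator S x)"
    by (auto simp: indicator_def)
  finally show ?thesis .
qed

lemma orlicz_integrand_measurable:
  fixes u :: "'a \<Rightarrow> real" and \<Phi> :: "real \<Rightarrow> ennreal"
  assumes "S \<in> sets M" "\<Phi> \<in> borel_measurable borel" "set_borel_measurable M S u"
  shows "(\<lambda>x. \<Phi> (\<bar>u x\<bar> / \<beta>) * indicator S x) \<in> borel_measurable M"
proof -
  have "(\<lambda>t. \<Phi> (\<bar>t\<bar> / \<beta>)) \<in> borel_measurable borel"
    using assms(2) by measurable
  from set_borel_measurable_compose_indicator[OF assms(1) this assms(3)] show ?thesis .
qed

lemma orlicz_modular_cong_AE: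
  assumes "AE x in lebesgue. x \<in> \<Omega> \<longrightarrow> u x = v x"
  shows "orlicz_modular \<Phi> \<Omega> \<beta> u = orlicz_modular \<Phi> \<Omega> \<beta> v"
  unfolding orlicz_modular_def
proof (rule nn_integral_cong_AE)
  show "AE x in lebesgue. \<Phi> (\<bar>u x\<bar> / \<beta>) * indicator \<Omega> x = \<Phi> (\<bar>v x\<bar> / \<beta>) * indicator \<Omega> x"
    using assms by eventually_elim (auto simp: indicator_def)
qed

text \<open>
  With \<open>m\<close> the larger of \<open>|a| / \<alpha>\<close> and \<open>|b| / \<beta>\<close>, the quotient \<open>|a + b| / (\<alpha> + \<beta>)\<close> is at most \<open>m\<close>.
  Monotonicity of \<open>\<Phi>\<close> thus suffices for a bound by the sum, in place of the sharper convex
  combination.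
\<close>

lemma orlicz_modular_add_le:
  assumes \<Phi>: "mono \<Phi>" "\<Phi> \<in> borel_measurable borel" and pos: "0 < \<alpha>" "0 < \<beta>"
    and \<Omega>: "\<Omega> \<in> sets lebesgue" "set_borel_measurable lebesgue \<Omega> u" "set_borel_measurable lebesgue \<Omega> v"
  shows "orlicz_modular \<Phi> \<Omega> (\<alpha> + \<beta>) (\<lambda>x. u x + v x) \<le>
    orlicz_modular \<Phi> \<Omega> \<alpha> u + orlicz_modular \<Phi> \<Omega> \<beta> v"
proof -
  have le: "\<Phi> (\<bar>a + b\<bar> / (\<alpha> + \<beta>)) \<le> \<Phi> (\<bar>a\<bar> / \<alpha>) + \<Phi> (\<bar>b\<bar> / \<beta>)" for a b
  proof -
    define m where "m = max (\<bar>a\<bar> / \<alpha>) (\<bar>b\<bar> / \<beta>)"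
    have "\<bar>a\<bar> / \<alpha> \<le> m" "\<bar>b\<bar> / \<beta> \<le> m"
      by (auto simp: m_def)
    then have "\<bar>a\<bar> \<le> m * \<alpha>" "\<bar>b\<bar> \<le> m * \<beta>"
      using pos by (simp_all add: pos_divide_le_eq)
    then have "\<bar>a + b\<bar> \<le> m * (\<alpha> + \<beta>)"
      unfolding distrib_left by linarith
    then have "\<bar>a + b\<bar> / (\<alpha> + \<beta>) \<le> m"
      using pos by (simp add: pos_divide_le_eq)
    then have "\<Phi> (\<bar>a + b\<bar> / (\<alpha> + \<beta>)) \<le> \<Phi> m"
      using \<Phi>(1) by (rule monoD[rotated])
    also have "\<dots> \<le> \<Phi> (\<bar>a\<bar> / \<alpha>) + \<Phi> (\<bar>b\<bar> / \<beta>)"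
      unfolding m_def by (simp add: max_def add_increasing add_increasing2)
    finally show ?thesis .
  qed
  have "orlicz_modular \<Phi> \<Omega> (\<alpha> + \<beta>) (\<lambda>x. u x + v x) \<le>
      (\<integral>\<^sup>+x. \<Phi> (\<bar>u x\<bar> / \<alpha>) * indicator \<Omega> x + \<Phi> (\<bar>v x\<bar> / \<beta>) * indicator \<Omega> x \<partial>lebesgue)"
    unfolding orlicz_modular_def
    by (intro nn_integral_mono) (use le in \<open>auto simp: indicator_def\<close>)
  also have "\<dots> = orlicz_modular \<Phi> \<Omega> \<alpha> u + orlicz_modular \<Phi> \<Omega> \<beta> v"
    unfolding orlicz_modular_def
    by (intro nn_integral_add orlicz_integrand_measurable \<Phi> \<Omega>)
  finally show ?thesis .
qed

text \<open>
  The scaling factor \<open>|c| + 1\<close>, rather than \<open>|c|\<close>, also covers \<open>c = 0\<close>.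
\<close>

lemma orlicz_modular_cmult_le:
  assumes "mono \<Phi>" "0 < \<beta>"
  shows "orlicz_modular \<Phi> \<Omega> (\<beta> * (\<bar>c\<bar> + 1)) (\<lambda>x. c * u x) \<le> orlicz_modular \<Phi> \<Omega> \<beta> u"
  unfolding orlicz_modular_def
proof (intro nn_integral_mono mult_right_mono monoD[OF assms(1)])
  fix x
  have "\<bar>c\<bar> / (\<bar>c\<bar> + 1) * (\<bar>u x\<bar> / \<beta>) \<le> 1 * (\<bar>u x\<bar> / \<beta>)"
    using assms(2) by (intro mult_right_mono) (auto simp: pos_divide_le_eq add_pos_nonneg)
  then show "\<bar>c * u x\<bar> / (\<beta> * (\<bar>c\<bar> + 1)) \<le> \<bar>u x\<bar> / \<beta>"
    by (simp add: abs_mult mult.commute)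
qed simp

lemma has_weak_partial_measurable:
  assumes "open \<Omega>" "has_weak_partial \<Omega> j u v"
  shows "set_borel_measurable lebesgue \<Omega> u"
    and "set_borel_measurable lebesgue \<Omega> (weak_partial \<Omega> j u)"
  using has_weak_partial_weak_partial[OF assms(2)] locally_integrable_set_borel_measurable[OF assms(1)]
  by (simp_all add: has_weak_partial_def)

lemma sobolev_modular_add_le:
  assumes \<Phi>: "mono \<Phi>" "\<Phi> \<in> borel_measurable borel" and pos: "0 < \<alpha>" "0 < \<beta>" and \<Omega>: "open \<Omega>"
    and u: "\<And>j. \<exists>w. has_weak_partial \<Omega> j u w" and v: "\<And>j. \<exists>w. has_weak_partial \<Omega> j v w"
  shows "sobolev_modular \<Phi> \<Omega> (\<alpha> + \<beta>) (\<lambda>x. u x + v x) \<le>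
    sobolev_modular \<Phi> \<Omega> \<alpha> u + sobolev_modular \<Phi> \<Omega> \<beta> v"
proof -
  have \<Omega>': "\<Omega> \<in> sets lebesgue" using \<Omega> by auto
  note meas = has_weak_partial_measurable[OF \<Omega>]
  have "orlicz_modular \<Phi> \<Omega> (\<alpha> + \<beta>) (\<lambda>x. u x + v x) \<le>
      orlicz_modular \<Phi> \<Omega> \<alpha> u + orlicz_modular \<Phi> \<Omega> \<beta> v"
    using u v meas(1) by (blast intro: orlicz_modular_add_le[OF \<Phi> pos \<Omega>'])
  moreover have "orlicz_modular \<Phi> \<Omega> (\<alpha> + \<beta>) (weak_partial \<Omega> j (\<lambda>x. u x + v x)) \<le>
      orlicz_modular \<Phi> \<Omega> \<alpha> (weak_partial \<Omega> j u) + orlicz_modular \<Phi> \<Omega> \<beta> (weak_partial \<Omega> j v)" for j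
  proof -
    obtain w w' where w: "has_weak_partial \<Omega> j u w" "has_weak_partial \<Omega> j v w'"
      using u v by blast
    show ?thesis
      unfolding orlicz_modular_cong_AE[OF weak_partial_add[OF \<Omega> w]]
      by (rule orlicz_modular_add_le[OF \<Phi> pos \<Omega>' meas(2)[OF w(1)] meas(2)[OF w(2)]])
  qed
  then have "(\<Sum>j\<in>UNIV. orlicz_modular \<Phi> \<Omega> (\<alpha> + \<beta>) (weak_partial \<Omega> j (\<lambda>x. u x + v x))) \<le>
      (\<Sum>j\<in>UNIV. orlicz_modular \<Phi> \<Omega> \<alpha> (weak_partial \<Omega> j u)) +
      (\<Sum>j\<in>UNIV. orlicz_modular \<Phi> \<Omega> \<beta> (weak_partial \<Omega> j v))"
    unfolding sum.distrib[symmetric] by (intro sum_mono)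
  ultimately show ?thesis
    unfolding sobolev_modular_def by (rule order_trans[OF add_mono]) (simp add: add_ac)
qed

lemma sobolev_modular_cmult_le:
  assumes \<Phi>: "mono \<Phi>" and pos: "0 < \<beta>" and \<Omega>: "open \<Omega>"
    and u: "\<And>j. \<exists>w. has_weak_partial \<Omega> j u w"
  shows "sobolev_modular \<Phi> \<Omega> (\<beta> * (\<bar>c\<bar> + 1)) (\<lambda>x. c * u x) \<le> sobolev_modular \<Phi> \<Omega> \<beta> u"
proof -
  have "orlicz_modular \<Phi> \<Omega> (\<beta> * (\<bar>c\<bar> + 1)) (weak_partial \<Omega> j (\<lambda>x. c * u x)) \<le>
      orlicz_modular \<Phi> \<Omega> \<beta> (weak_partial \<Omega> j u)" for j
  proof -
    obtain w where w: "has_weak_partial \<Omega> j u w"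
      using u by blast
    show ?thesis
      unfolding orlicz_modular_cong_AE[OF weak_partial_cmult[OF \<Omega> w]]
      by (rule orlicz_modular_cmult_le[OF \<Phi> pos])
  qed
  then show ?thesis
    unfolding sobolev_modular_def by (intro add_mono sum_mono orlicz_modular_cmult_le[OF \<Phi> pos])
qed

section \<open>Traces of sums and multiples\<close>

text \<open>
  This makes continuous functions measurable for the surface measure, in which traces are
  compared.
\<close>

lemma sets_surface_measure [measurable_cong, simp]: "sets (hausdorff_measure s) = sets borel"
  unfolding hausdorff_measure_def using sets.sigma_sets_eq[of borel] by (simp add: sets_measure_of_conv)

lemma nn_integral_abs_add_le:
  fixes p q :: "'a \<Rightarrow> real"
  assumes "S \<in> sets M" "set_borel_measurable M S p" "set_borel_measurable M S q"
  shows "(\<integral>\<^sup>+x\<in>S. ennreal \<bar>p x + q x\<bar> \<partial>M) \<le>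
    (\<integral>\<^sup>+x\<in>S. ennreal \<bar>p x\<bar> \<partial>M) + (\<integral>\<^sup>+x\<in>S. ennreal \<bar>q x\<bar> \<partial>M)"
proof -
  have meas: "(\<lambda>x. ennreal \<bar>r x\<bar> * indicator S x) \<in> borel_measurable M"
    if "set_borel_measurable M S r" for r :: "'a \<Rightarrow> real"
    by (rule set_borel_measurable_compose_indicator[OF assms(1) _ that, of "\<lambda>t. ennreal \<bar>t\<bar>"]) simp
  have "(\<integral>\<^sup>+x\<in>S. ennreal \<bar>p x + q x\<bar> \<partial>M) \<le>
      (\<integral>\<^sup>+x. ennreal \<bar>p x\<bar> * indicator S x + ennreal \<bar>q x\<bar> * indicator S x \<partial>M)"
    by (intro nn_integral_mono)
      (auto simp: indicator_def abs_triangle_ineq ennreal_leI simp flip: ennreal_plus)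
  also have "\<dots> = (\<integral>\<^sup>+x\<in>S. ennreal \<bar>p x\<bar> \<partial>M) + (\<integral>\<^sup>+x\<in>S. ennreal \<bar>q x\<bar> \<partial>M)"
    by (intro nn_integral_add meas assms)
  finally show ?thesis .
qed

lemma nn_integral_abs_cmult:
  fixes p :: "'a \<Rightarrow> real"
  assumes "S \<in> sets M" "set_borel_measurable M S p"
  shows "(\<integral>\<^sup>+x\<in>S. ennreal \<bar>c * p x\<bar> \<partial>M) = ennreal \<bar>c\<bar> * (\<integral>\<^sup>+x\<in>S. ennreal \<bar>p x\<bar> \<partial>M)"
proof -
  have meas: "(\<lambda>x. ennreal \<bar>p x\<bar> * indicator S x) \<in> borel_measurable M"
    by (rule set_borel_measurable_compose_indicator[OF assms(1) _ assms(2), of "\<lambda>t. ennreal \<bar>t\<bar>"]) simp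
  have "(\<integral>\<^sup>+x\<in>S. ennreal \<bar>c * p x\<bar> \<partial>M) =
      (\<integral>\<^sup>+x. ennreal \<bar>c\<bar> * (ennreal \<bar>p x\<bar> * indicator S x) \<partial>M)"
    by (simp add: abs_mult ennreal_mult mult.assoc)
  then show ?thesis by (simp add: nn_integral_cmult[OF meas])
qed

lemma C_k_set_borel_measurable:
  assumes "C_k k w" "S \<in> sets lebesgue"
  shows "set_borel_measurable lebesgue S w"
  using C_k_borel_lebesgue[OF assms(1)] assms(2) by (simp add: set_borel_measurable_def)

lemma C_k_set_borel_measurable_surface:
  assumes "C_k k w" "S \<in> sets borel"
  shows "set_borel_measurable (hausdorff_measure s) S w"
proof -
  have "w \<in> borel_measurable (hausdorff_measure s)"
    using borel_measurable_continuous_onI[OF C_k_continuous[OF assms(1)]]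
    by (simp cong: measurable_cong_sets)
  with assms(2) show ?thesis by (simp add: set_borel_measurable_def)
qed

text \<open>
  The \<open>W\<^sup>1\<^sup>,\<^sup>1\<close> distance used in the definition of traces, with the classical derivatives of the
  approximating function \<open>w\<close> and the weak derivatives of \<open>u\<close>.
\<close>

definition sobolev_1_1_distance ::
    "(real ^ 'n::finite) set \<Rightarrow> (real ^ 'n \<Rightarrow> real) \<Rightarrow> (real ^ 'n \<Rightarrow> real) \<Rightarrow> ennreal" where
  "sobolev_1_1_distance \<Omega> w u =
     (\<integral>\<^sup>+x\<in>\<Omega>. ennreal \<bar>w x - u x\<bar> \<partial>lebesgue) +
     (\<Sum>j\<in>UNIV. \<integral>\<^sup>+x\<in>\<Omega>. ennreal \<bar>partial j w x - weak_partial \<Omega> j u x\<bar> \<partial>lebesgue)"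

lemma sobolev_1_1_distance_add_le:
  assumes \<Omega>: "open \<Omega>" and w: "C_k 1 w" "C_k 1 w'"
    and u: "\<And>j. \<exists>v. has_weak_partial \<Omega> j u v" "\<And>j. \<exists>v. has_weak_partial \<Omega> j u' v"
  shows "sobolev_1_1_distance \<Omega> (\<lambda>x. w x + w' x) (\<lambda>x. u x + u' x) \<le>
    sobolev_1_1_distance \<Omega> w u + sobolev_1_1_distance \<Omega> w' u'"
proof -
  have \<Omega>': "\<Omega> \<in> sets lebesgue" using \<Omega> by auto
  have add_diff_swap: "(a + b) - (c + d) = (a - c) + (b - d)" for a b c d :: real by simp
  note meas = has_weak_partial_measurable[OF \<Omega>] C_k_set_borel_measurable[OF _ \<Omega>']
  have "(\<integral>\<^sup>+x\<in>\<Omega>. ennreal \<bar>w x + w' x - (u x + u' x)\<bar> \<partial>lebesgue) \<le>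
      (\<integral>\<^sup>+x\<in>\<Omega>. ennreal \<bar>w x - u x\<bar> \<partial>lebesgue) + (\<integral>\<^sup>+x\<in>\<Omega>. ennreal \<bar>w' x - u' x\<bar> \<partial>lebesgue)"
  proof -
    have "set_borel_measurable lebesgue \<Omega> u" "set_borel_measurable lebesgue \<Omega> u'"
      using u meas(1) by blast+
    then show ?thesis
      unfolding add_diff_swap
      by (intro nn_integral_abs_add_le \<Omega>' set_borel_measurable_diff meas(3)[OF w(1)] meas(3)[OF w(2)])
  qed
  moreover have "(\<integral>\<^sup>+x\<in>\<Omega>. ennreal \<bar>partial j (\<lambda>x. w x + w' x) x
      - weak_partial \<Omega> j (\<lambda>x. u x + u' x) x\<bar> \<partial>lebesgue)
      \<le> (\<integral>\<^sup>+x\<in>\<Omega>. ennreal \<bar>partial j w x - weak_partial \<Omega> j u x\<bar> \<partial>lebesgue) +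
        (\<integral>\<^sup>+x\<in>\<Omega>. ennreal \<bar>partial j w' x - weak_partial \<Omega> j u' x\<bar> \<partial>lebesgue)" for j
  proof -
    obtain v v' where v: "has_weak_partial \<Omega> j u v" "has_weak_partial \<Omega> j u' v'"
      using u by blast
    have C: "C_k 0 (partial j w)" "C_k 0 (partial j w')"
      using w by auto
    have "(\<integral>\<^sup>+x\<in>\<Omega>. ennreal \<bar>partial j (\<lambda>x. w x + w' x) x
        - weak_partial \<Omega> j (\<lambda>x. u x + u' x) x\<bar> \<partial>lebesgue)
        = (\<integral>\<^sup>+x\<in>\<Omega>. ennreal \<bar>(partial j w x - weak_partial \<Omega> j u x) +
            (partial j w' x - weak_partial \<Omega> j u' x)\<bar> \<partial>lebesgue)"
    proof (rule nn_integral_cong_AE)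
      have sum_rule: "partial j (\<lambda>x. w x + w' x) x = partial j w x + partial j w' x" for x
        using w by (intro partial_add) auto
      show "AE x in lebesgue. ennreal \<bar>partial j (\<lambda>x. w x + w' x) x
          - weak_partial \<Omega> j (\<lambda>x. u x + u' x) x\<bar> * indicator \<Omega> x
          = ennreal \<bar>(partial j w x - weak_partial \<Omega> j u x) +
            (partial j w' x - weak_partial \<Omega> j u' x)\<bar> * indicator \<Omega> x"
        using weak_partial_add[OF \<Omega> v]
        by eventually_elim (auto simp: indicator_def sum_rule add_diff_swap)
    qed
    also have "\<dots> \<le> (\<integral>\<^sup>+x\<in>\<Omega>. ennreal \<bar>partial j w x - weak_partial \<Omega> j u x\<bar> \<partial>lebesgue) +
        (\<integral>\<^sup>+x\<in>\<Omega>. ennreal \<bar>partial j w' x - weak_partial \<Omega> j u' x\<bar> \<partial>lebesgue)"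
      by (intro nn_integral_abs_add_le \<Omega>' set_borel_measurable_diff
          meas(3)[OF C(1)] meas(3)[OF C(2)] meas(2)[OF v(1)] meas(2)[OF v(2)])
    finally show ?thesis .
  qed
  then have "(\<Sum>j\<in>UNIV. \<integral>\<^sup>+x\<in>\<Omega>. ennreal \<bar>partial j (\<lambda>x. w x + w' x) x
      - weak_partial \<Omega> j (\<lambda>x. u x + u' x) x\<bar> \<partial>lebesgue)
      \<le> (\<Sum>j\<in>UNIV. \<integral>\<^sup>+x\<in>\<Omega>. ennreal \<bar>partial j w x - weak_partial \<Omega> j u x\<bar> \<partial>lebesgue) +
        (\<Sum>j\<in>UNIV. \<integral>\<^sup>+x\<in>\<Omega>. ennreal \<bar>partial j w' x - weak_partial \<Omega> j u' x\<bar> \<partial>lebesgue)"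
    unfolding sum.distrib[symmetric] by (intro sum_mono)
  ultimately show ?thesis
    unfolding sobolev_1_1_distance_def by (rule order_trans[OF add_mono]) (simp add: add_ac)
qed

lemma sobolev_1_1_distance_cmult:
  assumes \<Omega>: "open \<Omega>" and w: "C_k 1 w" and u: "\<And>j. \<exists>v. has_weak_partial \<Omega> j u v"
  shows "sobolev_1_1_distance \<Omega> (\<lambda>x. c * w x) (\<lambda>x. c * u x) =
    ennreal \<bar>c\<bar> * sobolev_1_1_distance \<Omega> w u"
proof -
  have \<Omega>': "\<Omega> \<in> sets lebesgue" using \<Omega> by auto
  note meas = has_weak_partial_measurable[OF \<Omega>] C_k_set_borel_measurable[OF _ \<Omega>']
  have "(\<integral>\<^sup>+x\<in>\<Omega>. ennreal \<bar>c * w x - c * u x\<bar> \<partial>lebesgue) =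
      ennreal \<bar>c\<bar> * (\<integral>\<^sup>+x\<in>\<Omega>. ennreal \<bar>w x - u x\<bar> \<partial>lebesgue)"
  proof -
    have "set_borel_measurable lebesgue \<Omega> u"
      using u meas(1) by blast
    then show ?thesis
      unfolding right_diff_distrib[symmetric]
      by (intro nn_integral_abs_cmult \<Omega>' set_borel_measurable_diff meas(3)[OF w])
  qed
  moreover have "(\<integral>\<^sup>+x\<in>\<Omega>. ennreal \<bar>partial j (\<lambda>x. c * w x) x - weak_partial \<Omega> j (\<lambda>x. c
      * u x) x\<bar> \<partial>lebesgue)
      = ennreal \<bar>c\<bar> * (\<integral>\<^sup>+x\<in>\<Omega>. ennreal \<bar>partial j w x - weak_partial \<Omega> j u x\<bar> \<partial>lebesgue)" for j
  proof -
    obtain v where v: "has_weak_partial \<Omega> j u v"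
      using u by blast
    have C: "C_k 0 (partial j w)"
      using w by auto
    have "(\<integral>\<^sup>+x\<in>\<Omega>. ennreal \<bar>partial j (\<lambda>x. c * w x) x - weak_partial \<Omega> j (\<lambda>x. c * u x) x\<bar> \<partial>lebesgue)
        = (\<integral>\<^sup>+x\<in>\<Omega>. ennreal \<bar>c * (partial j w x - weak_partial \<Omega> j u x)\<bar> \<partial>lebesgue)"
    proof (rule nn_integral_cong_AE)
      have scale_rule: "partial j (\<lambda>x. c * w x) x = c * partial j w x" for x
        using w by (subst partial_mult) (auto simp: partial_def)
      show "AE x in lebesgue. ennreal \<bar>partial j (\<lambda>x. c * w x) x - weak_partial \<Omega> j (\<lambda>x. c * u x) x\<bar>
          * indicator \<Omega> x
          = ennreal \<bar>c * (partial j w x - weak_partial \<Omega> j u x)\<bar> * indicator \<Omega> x"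
        using weak_partial_cmult[OF \<Omega> v, of c]
        by eventually_elim (auto simp: indicator_def scale_rule right_diff_distrib)
    qed
    also have "\<dots> = ennreal \<bar>c\<bar> * (\<integral>\<^sup>+x\<in>\<Omega>. ennreal \<bar>partial j w x - weak_partial \<Omega> j u x\<bar> \<partial>lebesgue)"
      by (intro nn_integral_abs_cmult \<Omega>' set_borel_measurable_diff meas(3)[OF C] meas(2)[OF v])
    finally show ?thesis .
  qed
  ultimately show ?thesis
    unfolding sobolev_1_1_distance_def by (simp add: distrib_left sum_distrib_left)
qed

text \<open>
  Approximating sequences may be added: both distances satisfy the triangle inequality.
\<close>

lemma has_trace_add:
  assumes \<Omega>: "open \<Omega>"
    and u: "\<And>j. \<exists>v. has_weak_partial \<Omega> j u v" "\<And>j. \<exists>v. has_weak_partial \<Omega> j u' v"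
    and tr: "has_trace \<Omega> u T" "has_trace \<Omega> u' T'"
  shows "has_trace \<Omega> (\<lambda>x. u x + u' x) (\<lambda>x. T x + T' x)"
proof -
  let ?B = "\<lambda>w T. \<integral>\<^sup>+x\<in>frontier \<Omega>. ennreal \<bar>w x - T x\<bar> \<partial>surface_measure"
  have T: "set_integrable surface_measure (frontier \<Omega>) T" "set_integrable surface_measure (frontier \<Omega>) T'"
    using tr by (simp_all add: has_trace_def)
  obtain w where w: "\<And>k. C_k 1 (w k)" "(\<lambda>k. sobolev_1_1_distance \<Omega> (w k) u) \<longlonglongrightarrow> 0" "(\<lambda>k. ?B (w k) T) \<longlonglongrightarrow> 0"
    using tr(1) unfolding has_trace_def sobolev_1_1_distance_def by blast
  obtain w' where w': "\<And>k. C_k 1 (w' k)" "(\<lambda>k. sobolev_1_1_distance \<Omega> (w' k) u')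
      \<longlonglongrightarrow> 0" "(\<lambda>k. ?B (w' k) T') \<longlonglongrightarrow> 0"
    using tr(2) unfolding has_trace_def sobolev_1_1_distance_def by blast
  have sum0: "(\<lambda>k. a k + b k) \<longlonglongrightarrow> 0" if "a \<longlonglongrightarrow> 0" "b \<longlonglongrightarrow> 0" for a b :: "nat \<Rightarrow> ennreal"
    using tendsto_add[OF that] by simp
  have squeeze: "a \<longlonglongrightarrow> 0" if "\<And>k. a k \<le> b k" "b \<longlonglongrightarrow> 0" for a b :: "nat \<Rightarrow> ennreal"
    by (rule tendsto_sandwich[OF _ _ tendsto_const that(2)]) (use that(1) in auto)
  have "C_k 1 (\<lambda>x. w k x + w' k x)" for k
    by (intro C_k_add w(1) w'(1))
  moreover have "(\<lambda>k. sobolev_1_1_distance \<Omega> (\<lambda>x. w k x + w' k x) (\<lambda>x. u x + u' x)) \<longlonglongrightarrow> 0"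
    by (rule squeeze[OF sobolev_1_1_distance_add_le[OF \<Omega> w(1) w'(1) u] sum0[OF w(2) w'(2)]])
  moreover have "(\<lambda>k. ?B (\<lambda>x. w k x + w' k x) (\<lambda>x. T x + T' x)) \<longlonglongrightarrow> 0"
  proof (rule squeeze[OF _ sum0[OF w(3) w'(3)]])
    fix k
    have S: "frontier \<Omega> \<in> sets surface_measure"
      by (simp add: borel_closed)
    have "set_borel_measurable surface_measure (frontier \<Omega>) T"
      "set_borel_measurable surface_measure (frontier \<Omega>) T'"
      using T by (auto simp: set_integrable_def set_borel_measurable_def)
    then have "(\<integral>\<^sup>+x\<in>frontier \<Omega>. ennreal \<bar>(w k x - T x) + (w' k x - T' x)\<bar> \<partial>surface_measure) \<le>
        ?B (w k) T + ?B (w' k) T'"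
      using S by (intro nn_integral_abs_add_le set_borel_measurable_diff
          C_k_set_borel_measurable_surface[OF w(1)] C_k_set_borel_measurable_surface[OF w'(1)]) auto
    then show "?B (\<lambda>x. w k x + w' k x) (\<lambda>x. T x + T' x) \<le> ?B (w k) T + ?B (w' k) T'"
      by (simp add: algebra_simps)
  qed
  moreover have "set_integrable surface_measure (frontier \<Omega>) (\<lambda>x. T x + T' x)"
    by (intro set_integral_add T)
  ultimately show ?thesis
    unfolding has_trace_def sobolev_1_1_distance_def
    by (intro conjI exI[of _ "\<lambda>k x. w k x + w' k x"]) auto
qed

lemma has_trace_cmult:
  assumes \<Omega>: "open \<Omega>" and u: "\<And>j. \<exists>v. has_weak_partial \<Omega> j u v" and tr: "has_trace \<Omega> u T"
  shows "has_trace \<Omega> (\<lambda>x. c * u x) (\<lambda>x. c * T x)"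
proof -
  let ?B = "\<lambda>w T. \<integral>\<^sup>+x\<in>frontier \<Omega>. ennreal \<bar>w x - T x\<bar> \<partial>surface_measure"
  have T: "set_integrable surface_measure (frontier \<Omega>) T"
    using tr by (simp add: has_trace_def)
  obtain w where w: "\<And>k. C_k 1 (w k)" "(\<lambda>k. sobolev_1_1_distance \<Omega> (w k) u) \<longlonglongrightarrow> 0" "(\<lambda>k. ?B (w k) T) \<longlonglongrightarrow> 0"
    using tr unfolding has_trace_def sobolev_1_1_distance_def by blast
  have scale0: "(\<lambda>k. ennreal \<bar>c\<bar> * a k) \<longlonglongrightarrow> 0" if "a \<longlonglongrightarrow> 0" for a :: "nat \<Rightarrow> ennreal"
    using ennreal_tendsto_cmult[OF _ that, of "ennreal \<bar>c\<bar>"] by simp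
  have "C_k 1 (\<lambda>x. c * w k x)" for k
    by (intro C_k_mult C_k_const w(1))
  moreover have "(\<lambda>k. sobolev_1_1_distance \<Omega> (\<lambda>x. c * w k x) (\<lambda>x. c * u x)) \<longlonglongrightarrow> 0"
    unfolding sobolev_1_1_distance_cmult[OF \<Omega> w(1) u] by (rule scale0[OF w(2)])
  moreover have "(\<lambda>k. ?B (\<lambda>x. c * w k x) (\<lambda>x. c * T x)) \<longlonglongrightarrow> 0"
  proof -
    have "set_borel_measurable surface_measure (frontier \<Omega>) T"
      using T by (auto simp: set_integrable_def set_borel_measurable_def)
    then have "?B (\<lambda>x. c * w k x) (\<lambda>x. c * T x) = ennreal \<bar>c\<bar> * ?B (w k) T" for k
      unfolding right_diff_distrib[symmetric]
      by (intro nn_integral_abs_cmult set_borel_measurable_diff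
          C_k_set_borel_measurable_surface[OF w(1)]) (auto simp: borel_closed)
    then show ?thesis
      using scale0[OF w(3)] by (simp only:)
  qed
  moreover have "set_integrable surface_measure (frontier \<Omega>) (\<lambda>x. c * T x)"
    using T by simp
  ultimately show ?thesis
    unfolding has_trace_def sobolev_1_1_distance_def
    by (intro conjI exI[of _ "\<lambda>k x. c * w k x"]) auto
qed

section \<open>The Orlicz--Sobolev space with zero trace is a vector space\<close>

lemma sobolev_space_0_weak_partial:
  assumes "g \<in> sobolev_space_0 \<Phi> \<Omega>"
  shows "\<exists>v. has_weak_partial \<Omega> j (\<lambda>x. g x $ A) v"
  using assms by (simp add: sobolev_space_0_def sobolev_space_def)

text \<open>
  The functionals in the negative space are additive on \<open>W\<^sub>0\<close>, so \<open>W\<^sub>0\<close> itself must be closed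
  under addition; off \<open>W\<^sub>0\<close> the Dirac functional is undefined.
\<close>

lemma sobolev_space_0_add:
  assumes \<Phi>: "mono \<Phi>" "\<Phi> \<in> borel_measurable borel" and \<Omega>: "open \<Omega>"
    and g: "g \<in> sobolev_space_0 \<Phi> \<Omega>" and h: "h \<in> sobolev_space_0 \<Phi> \<Omega>"
  shows "(\<lambda>x. g x + h x) \<in> sobolev_space_0 \<Phi> \<Omega>"
proof -
  note wg = sobolev_space_0_weak_partial[OF g] and wh = sobolev_space_0_weak_partial[OF h]
  have "locally_integrable \<Omega> (\<lambda>x. g x $ A + h x $ A)" for A
    using g h by (intro locally_integrable_add) (simp_all add: sobolev_space_0_def sobolev_space_def)
  moreover have "\<exists>v. has_weak_partial \<Omega> j (\<lambda>x. g x $ A + h x $ A) v" for A j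
    using wg wh has_weak_partial_add by blast
  moreover have "\<exists>\<gamma>>0. sobolev_modular \<Phi> \<Omega> \<gamma> (\<lambda>x. g x $ A + h x $ A) < \<infinity>" for A
  proof -
    obtain \<alpha> \<beta> where "0 < \<alpha>" "sobolev_modular \<Phi> \<Omega> \<alpha> (\<lambda>x. g x $ A) < \<infinity>"
      and "0 < \<beta>" "sobolev_modular \<Phi> \<Omega> \<beta> (\<lambda>x. h x $ A) < \<infinity>"
      using g h unfolding sobolev_space_0_def sobolev_space_def by blast
    then show ?thesis
      using sobolev_modular_add_le[OF \<Phi> _ _ \<Omega> wg wh, of \<alpha> \<beta> A A]
      by (intro exI[of _ "\<alpha> + \<beta>"]) (auto intro: le_less_trans)
  qed
  moreover have "has_trace \<Omega> (\<lambda>x. g x $ A + h x $ A) (\<lambda>x. 0)" for A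
    using has_trace_add[OF \<Omega> wg wh, where T = "\<lambda>x. 0" and T' = "\<lambda>x. 0"] g h
    by (simp add: sobolev_space_0_def)
  ultimately show ?thesis
    by (simp add: sobolev_space_0_def sobolev_space_def)
qed

lemma sobolev_space_0_scaleR:
  assumes \<Phi>: "mono \<Phi>" and \<Omega>: "open \<Omega>" and g: "g \<in> sobolev_space_0 \<Phi> \<Omega>"
  shows "(\<lambda>x. c *\<^sub>R g x) \<in> sobolev_space_0 \<Phi> \<Omega>"
proof -
  note wg = sobolev_space_0_weak_partial[OF g]
  have "locally_integrable \<Omega> (\<lambda>x. c * g x $ A)" for A
    using g by (intro locally_integrable_cmult) (simp_all add: sobolev_space_0_def sobolev_space_def)
  moreover have "\<exists>v. has_weak_partial \<Omega> j (\<lambda>x. c * g x $ A) v" for A j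
    using wg has_weak_partial_cmult by blast
  moreover have "\<exists>\<gamma>>0. sobolev_modular \<Phi> \<Omega> \<gamma> (\<lambda>x. c * g x $ A) < \<infinity>" for A
  proof -
    obtain \<beta> where "0 < \<beta>" "sobolev_modular \<Phi> \<Omega> \<beta> (\<lambda>x. g x $ A) < \<infinity>"
      using g unfolding sobolev_space_0_def sobolev_space_def by blast
    then show ?thesis
      using sobolev_modular_cmult_le[OF \<Phi> _ \<Omega> wg, of \<beta> c A]
      by (intro exI[of _ "\<beta> * (\<bar>c\<bar> + 1)"]) (auto intro: le_less_trans mult_pos_pos add_nonneg_pos)
  qed
  moreover have "has_trace \<Omega> (\<lambda>x. c * g x $ A) (\<lambda>x. 0)" for A
    using has_trace_cmult[OF \<Omega> wg, where T = "\<lambda>x. 0"] g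
    by (simp add: sobolev_space_0_def)
  ultimately show ?thesis
    by (simp add: sobolev_space_0_def sobolev_space_def)
qed

section \<open>The Hoelder inequality in Orlicz spaces\<close>

text \<open>
  The term for \<open>s\<close> in the supremum defining \<open>\<psi>\<^sup>*(t)\<close> is \<open>s t - \<psi>(s)\<close>.
\<close>

lemma young_inequality:
  assumes "orlicz_function \<psi>" "0 \<le> s"
  shows "ennreal (s * t) \<le> ennreal (\<psi> s) + orlicz_conjugate \<psi> t"
proof -
  have pos: "0 \<le> \<psi> s" using assms by (simp add: orlicz_function_def)
  have "ennreal (s * t) \<le> ennreal (\<psi> s) + ennreal (s * t - \<psi> s)"
  proof (cases "\<psi> s \<le> s * t")
    case True
    then show ?thesis using pos by (simp flip: ennreal_plus)
  next
    case False
    then have "ennreal (s * t) \<le> ennreal (\<psi> s)" by (intro ennreal_leI) simp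
    then show ?thesis by (rule add_increasing2[rotated]) simp
  qed
  also have "ennreal (s * t - \<psi> s) \<le> orlicz_conjugate \<psi> t"
    unfolding orlicz_conjugate_def using assms(2) by (intro SUP_upper) simp
  finally show ?thesis by (simp add: add_left_mono)
qed

text \<open>
  Integrate Young's inequality for \<open>|u| / \<alpha>\<close> and \<open>|v| / \<beta>\<close>. With both scales left free, the
  estimate serves for integrability, at scales of finite modulars, as well as for the norm bound,
  by an infimum over one scale.
\<close>

lemma orlicz_hoelder:
  fixes u v :: "real ^ 'n::finite \<Rightarrow> real"
  assumes \<psi>: "orlicz_function \<psi>" and pos: "0 < \<alpha>" "0 < \<beta>"
    and \<Omega>: "\<Omega> \<in> sets lebesgue" "set_borel_measurable lebesgue \<Omega> u" "set_borel_measurable lebesgue \<Omega> v"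
  shows "(\<integral>\<^sup>+x\<in>\<Omega>. ennreal \<bar>u x * v x\<bar> \<partial>lebesgue) \<le> ennreal (\<alpha> * \<beta>) *
    (orlicz_modular (\<lambda>t. ennreal (\<psi> t)) \<Omega> \<alpha> u + orlicz_modular (orlicz_conjugate \<psi>) \<Omega> \<beta> v)"
proof -
  \<comment> \<open>\<open>\<psi>\<close> is constrained on \<open>[0, \<infinity>)\<close> only, so its values on negative numbers are replaced.\<close>
  define \<Psi> where "\<Psi> t = ennreal (\<psi> (max 0 t))" for t
  have "mono (\<lambda>t. \<psi> (max 0 t))"
    using \<psi> by (auto simp: orlicz_function_def mono_on_def intro!: monoI)
  then have [measurable]: "(\<lambda>t. \<psi> (max 0 t)) \<in> borel_measurable borel"
    by (rule borel_measurable_mono)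
  have "\<Psi> \<in> borel_measurable borel" unfolding \<Psi>_def by measurable
  from orlicz_integrand_measurable[OF \<Omega>(1) this \<Omega>(2), of \<alpha>]
  have meas_u: "(\<lambda>x. ennreal (\<psi> (\<bar>u x\<bar> / \<alpha>)) * indicator \<Omega> x) \<in> borel_measurable lebesgue"
    using pos by (simp add: \<Psi>_def max_absorb2)
  have meas_v: "(\<lambda>x. orlicz_conjugate \<psi> (\<bar>v x\<bar> / \<beta>) * indicator \<Omega> x) \<in> borel_measurable lebesgue"
    by (rule orlicz_integrand_measurable[OF \<Omega>(1) orlicz_conjugate_borel \<Omega>(3)])
  have le: "ennreal \<bar>a * b\<bar> \<le> ennreal (\<alpha> * \<beta>) *
      (ennreal (\<psi> (\<bar>a\<bar> / \<alpha>)) + orlicz_conjugate \<psi> (\<bar>b\<bar> / \<beta>))" for a b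
  proof -
    have "ennreal \<bar>a * b\<bar> = ennreal (\<alpha> * \<beta>) * ennreal (\<bar>a\<bar> / \<alpha> * (\<bar>b\<bar> / \<beta>))"
      using pos by (simp add: abs_mult flip: ennreal_mult)
    also have "\<dots> \<le> ennreal (\<alpha> * \<beta>) *
        (ennreal (\<psi> (\<bar>a\<bar> / \<alpha>)) + orlicz_conjugate \<psi> (\<bar>b\<bar> / \<beta>))"
      using pos by (intro mult_left_mono young_inequality[OF \<psi>]) auto
    finally show ?thesis .
  qed
  have "(\<integral>\<^sup>+x\<in>\<Omega>. ennreal \<bar>u x * v x\<bar> \<partial>lebesgue) \<le>
      (\<integral>\<^sup>+x. ennreal (\<alpha> * \<beta>) * (ennreal (\<psi> (\<bar>u x\<bar> / \<alpha>)) * indicator \<Omega> x +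
        orlicz_conjugate \<psi> (\<bar>v x\<bar> / \<beta>) * indicator \<Omega> x) \<partial>lebesgue)"
    by (intro nn_integral_mono) (use le in \<open>auto simp: indicator_def\<close>)
  also have "\<dots> = ennreal (\<alpha> * \<beta>) *
    (orlicz_modular (\<lambda>t. ennreal (\<psi> t)) \<Omega> \<alpha> u + orlicz_modular (orlicz_conjugate \<psi>) \<Omega> \<beta> v)"
    unfolding orlicz_modular_def
    by (subst nn_integral_cmult[OF borel_measurable_add[OF meas_u meas_v]],
        subst nn_integral_add[OF meas_u meas_v]) simp
  finally show ?thesis .
qed

lemma orlicz_modular_weak_partial_le:
  "orlicz_modular \<Phi> \<Omega> \<beta> (weak_partial \<Omega> j u) \<le> sobolev_modular \<Phi> \<Omega> \<beta> u"
proof -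
  have "orlicz_modular \<Phi> \<Omega> \<beta> (weak_partial \<Omega> j u) \<le>
      (\<Sum>j\<in>UNIV. orlicz_modular \<Phi> \<Omega> \<beta> (weak_partial \<Omega> j u))"
    by (rule member_le_sum) auto
  then show ?thesis
    unfolding sobolev_modular_def by (rule add_increasing[rotated]) simp
qed

text \<open>
  The set \<open>S\<close> may be empty; the infimum is then \<open>\<infinity>\<close>, and \<open>c > 0\<close> keeps the right hand side
  infinite.
\<close>

lemma ennreal_le_mult_INF:
  fixes X :: ennreal
  assumes "0 < c" "\<And>b. b \<in> S \<Longrightarrow> X \<le> ennreal c * f b"
  shows "X \<le> ennreal c * (INF b\<in>S. f b)"
proof -
  have inv: "ennreal (1 / c) * (ennreal c * y) = y" "ennreal c * (ennreal (1 / c) * y) = y" for y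
    using assms(1) by (simp_all add: mult.assoc[symmetric] flip: ennreal_mult)
  have "ennreal (1 / c) * X \<le> f b" if "b \<in> S" for b
    using mult_left_mono[OF assms(2)[OF that], of "ennreal (1 / c)"] by (simp add: inv)
  then have "ennreal (1 / c) * X \<le> (INF b\<in>S. f b)"
    by (rule INF_greatest)
  from mult_left_mono[OF this, of "ennreal c"] show ?thesis by (simp add: inv)
qed

text \<open>
  Let \<open>M\<close> be the finite modular of \<open>f\<^sub>A\<close> at the scale \<open>\<alpha>\<close>. For every \<open>\<beta>\<close> admissible in the norm of
  \<open>g\<^sub>B\<close>, the modular of the derivative is at most \<open>1\<close>, so the integral is at most \<open>\<alpha> \<beta> (M + 1)\<close>. The
  infimum over \<open>\<beta>\<close> gives the bound with the constant \<open>C = \<alpha> (M + 1)\<close>, which does not depend on \<open>g\<close>.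
  Integrability uses instead a scale \<open>\<beta>\<close> at which the modular of \<open>g\<^sub>B\<close> is merely finite.
\<close>

lemma orlicz_sobolev_pairing:
  fixes f :: "real ^ 'n::finite \<Rightarrow> 'n clifford"
  assumes \<psi>: "orlicz_function \<psi>" and \<Omega>: "open \<Omega>"
    and f: "f \<in> orlicz_space \<psi> \<Omega>"
  obtains C where "0 < C"
    and "\<And>g j B. g \<in> sobolev_space_0 (orlicz_conjugate \<psi>) \<Omega> \<Longrightarrow>
      set_integrable lebesgue \<Omega> (\<lambda>x. f x $ A * weak_partial \<Omega> j (\<lambda>y. g y $ B) x)"
    and "\<And>g j B. g \<in> sobolev_space_0 (orlicz_conjugate \<psi>) \<Omega> \<Longrightarrow>
      (\<integral>\<^sup>+x\<in>\<Omega>. ennreal \<bar>f x $ A * weak_partial \<Omega> j (\<lambda>y. g y $ B) x\<bar> \<partial>lebesgue) \<le>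
      ennreal C * sobolev_norm (orlicz_conjugate \<psi>) \<Omega> g"
proof -
  let ?M = "\<lambda>\<alpha>. orlicz_modular (\<lambda>t. ennreal (\<psi> t)) \<Omega> \<alpha> (\<lambda>x. f x $ A)"
  have \<Omega>': "\<Omega> \<in> sets lebesgue" using \<Omega> by auto
  have f_meas: "set_borel_measurable lebesgue \<Omega> (\<lambda>x. f x $ A)"
    using f by (intro locally_integrable_set_borel_measurable[OF \<Omega>]) (simp add: orlicz_space_def)
  obtain \<alpha> where \<alpha>: "0 < \<alpha>" "?M \<alpha> < \<infinity>"
    using f by (auto simp: orlicz_space_def)
  obtain m where m: "0 \<le> m" "?M \<alpha> = ennreal m"
    using \<alpha>(2) by (cases "?M \<alpha>") auto
  define C where "C = \<alpha> * (m + 1)"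
  have C: "0 < C" using \<alpha>(1) m(1) by (simp add: C_def add_nonneg_pos)
  have g_meas: "set_borel_measurable lebesgue \<Omega> (weak_partial \<Omega> j (\<lambda>y. g y $ B))"
    if "g \<in> sobolev_space_0 (orlicz_conjugate \<psi>) \<Omega>" for g j B
    using sobolev_space_0_weak_partial[OF that] has_weak_partial_measurable(2)[OF \<Omega>] by blast
  note hoelder = orlicz_hoelder[OF \<psi> \<alpha>(1) _ \<Omega>' f_meas g_meas]
  show thesis
  proof
    show "0 < C" by (rule C)
    fix g j B assume g: "g \<in> sobolev_space_0 (orlicz_conjugate \<psi>) \<Omega>"
    let ?v = "weak_partial \<Omega> j (\<lambda>y. g y $ B)"
    let ?I = "\<integral>\<^sup>+x\<in>\<Omega>. ennreal \<bar>f x $ A * ?v x\<bar> \<partial>lebesgue"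
    show "set_integrable lebesgue \<Omega> (\<lambda>x. f x $ A * ?v x)"
      unfolding set_integrable_def
    proof (rule integrableI_bounded)
      have "(\<lambda>x. (indicator \<Omega> x *\<^sub>R f x $ A) * (indicator \<Omega> x *\<^sub>R ?v x)) \<in> borel_measurable lebesgue"
        using f_meas g_meas[OF g] unfolding set_borel_measurable_def by (rule borel_measurable_times)
      then show "(\<lambda>x. indicat_real \<Omega> x *\<^sub>R (f x $ A * ?v x)) \<in> borel_measurable lebesgue"
        by (rule measurable_cong[THEN iffD1, rotated]) (simp add: indicator_def)
      obtain \<beta> where \<beta>: "0 < \<beta>" "sobolev_modular (orlicz_conjugate \<psi>) \<Omega> \<beta> (\<lambda>x. g x $ B) < \<infinity>"
        using g unfolding sobolev_space_0_def sobolev_space_def by blast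
      have "orlicz_modular (orlicz_conjugate \<psi>) \<Omega> \<beta> ?v < \<infinity>"
        by (rule le_less_trans[OF orlicz_modular_weak_partial_le \<beta>(2)])
      then have "ennreal (\<alpha> * \<beta>) * (?M \<alpha> + orlicz_modular (orlicz_conjugate \<psi>) \<Omega> \<beta> ?v) < \<infinity>"
        using \<alpha>(2) by (simp add: ennreal_mult_less_top)
      with hoelder[OF \<beta>(1) g, of j B] have "?I < \<infinity>" by (rule le_less_trans)
      also have "?I = (\<integral>\<^sup>+x. ennreal (norm (indicat_real \<Omega> x *\<^sub>R (f x $ A * ?v x))) \<partial>lebesgue)"
        by (intro nn_integral_cong) (simp add: indicator_def)
      finally show "(\<integral>\<^sup>+x. ennreal (norm (indicat_real \<Omega> x *\<^sub>R (f x $ A * ?v x))) \<partial>lebesgue) < \<infinity>" .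
    qed
    let ?S = "\<lambda>B. {\<beta>. 0 < \<beta> \<and> sobolev_modular (orlicz_conjugate \<psi>) \<Omega> \<beta> (\<lambda>x. g x $ B) \<le> 1}"
    have "?I \<le> ennreal C * (INF \<beta>\<in>?S B. ennreal \<beta>)"
    proof (rule ennreal_le_mult_INF[OF C])
      fix \<beta> assume \<beta>: "\<beta> \<in> ?S B"
      then have "orlicz_modular (orlicz_conjugate \<psi>) \<Omega> \<beta> ?v \<le> 1"
        using orlicz_modular_weak_partial_le order_trans by blast
      then have "?M \<alpha> + orlicz_modular (orlicz_conjugate \<psi>) \<Omega> \<beta> ?v \<le> ennreal m + 1"
        unfolding m(2) by (rule add_left_mono)
      also have "\<dots> = ennreal (m + 1)"
        using m(1) by simp
      finally have "?M \<alpha> + orlicz_modular (orlicz_conjugate \<psi>) \<Omega> \<beta> ?v \<le> ennreal (m + 1)" .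
      then have "?I \<le> ennreal (\<alpha> * \<beta>) * ennreal (m + 1)"
        using \<beta> by (intro order_trans[OF hoelder[OF _ g] mult_left_mono]) auto
      also have "\<dots> = ennreal C * ennreal \<beta>"
        using \<alpha>(1) \<beta> m(1) by (simp add: C_def mult_ac del: ennreal_plus flip: ennreal_mult)
      finally show "?I \<le> ennreal C * ennreal \<beta>" .
    qed
    also have "(INF \<beta>\<in>?S B. ennreal \<beta>) \<le> sobolev_norm (orlicz_conjugate \<psi>) \<Omega> g"
      unfolding sobolev_norm_def by (rule member_le_sum[where f = "\<lambda>B. INF \<beta>\<in>?S B. ennreal \<beta>"]) auto
    finally show "?I \<le> ennreal C * sobolev_norm (orlicz_conjugate \<psi>) \<Omega> g"
      by (simp add: mult_left_mono)
  qed
qed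

section \<open>The pairing with the Dirac operator\<close>

lemma clifford_expansion: "a = (\<Sum>A\<in>UNIV. (a $ A) *\<^sub>R cl_basis A)"
  by (simp add: vec_eq_iff cl_basis_def axis_def sum_component if_distrib[of "\<lambda>t. _ * t"] cong: if_cong)

text \<open>
  The structure constants \<open>e\<^sub>A\<^sup>* e\<^sub>j e\<^sub>B\<close>, the star denoting Clifford conjugation, by which the pairing
  of \<open>f\<close> with \<open>D g\<close> reduces to the scalar products \<open>f\<^sub>A \<partial>\<^sub>j g\<^sub>B\<close>.
\<close>

definition dirac_coefficient :: "'n::{finite,linorder} set \<Rightarrow> 'n \<Rightarrow> 'n set \<Rightarrow> 'n clifford" where
  "dirac_coefficient A j B = cl_mult (cl_conj (cl_basis A)) (cl_mult (cl_basis {j}) (cl_basis B))"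

lemma clifford_pairing_expansion:
  "cl_mult (cl_conj a) (\<Sum>j\<in>UNIV. cl_mult (cl_basis {j}) (\<chi> B. d j B)) =
    (\<Sum>A\<in>UNIV. \<Sum>j\<in>UNIV. \<Sum>B\<in>UNIV. (a $ A * d j B) *\<^sub>R dirac_coefficient A j B)"
proof -
  have "cl_mult (cl_conj a) y = (\<Sum>A\<in>UNIV. (a $ A) *\<^sub>R cl_mult (cl_conj (cl_basis A)) y)" for y
    by (subst clifford_expansion[of a])
      (simp only: linear_sum[OF linear_cl_conj] linear_sum[OF linear_cl_mult_left]
        linear_cmul[OF linear_cl_conj] linear_cmul[OF linear_cl_mult_left] o_def)
  note expand_left = this
  have "cl_mult (cl_basis {j}) (\<chi> B. d j B)
      = (\<Sum>B\<in>UNIV. d j B *\<^sub>R cl_mult (cl_basis {j}) (cl_basis B))" for j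
    by (subst clifford_expansion)
      (simp only: linear_sum[OF linear_cl_mult_right] linear_cmul[OF linear_cl_mult_right] o_def vec_lambda_beta)
  note expand_right = this
  show ?thesis
    by (subst expand_left)
      (simp only: expand_right dirac_coefficient_def linear_sum[OF linear_cl_mult_right]
        linear_cmul[OF linear_cl_mult_right] o_def scaleR_sum_right scaleR_scaleR)
qed

lemma dirac_cong_AE:
  assumes "AE x in lebesgue. x \<in> \<Omega> \<longrightarrow> g x = h x"
  shows "dirac \<Omega> g = dirac \<Omega> h"
proof -
  have "weak_partial \<Omega> j (\<lambda>y. g y $ A) = weak_partial \<Omega> j (\<lambda>y. h y $ A)" for j A
    by (rule weak_partial_cong_AE) (use assms in \<open>eventually_elim, auto\<close>)
  then show ?thesis
    by (simp add: dirac_def fun_eq_iff)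
qed

lemma dirac_add:
  assumes \<Omega>: "open \<Omega>" and g: "g \<in> sobolev_space_0 \<Phi> \<Omega>" and h: "h \<in> sobolev_space_0 \<Phi> \<Omega>"
  shows "AE x in lebesgue. x \<in> \<Omega> \<longrightarrow> dirac \<Omega> (\<lambda>x. g x + h x) x = dirac \<Omega> g x + dirac \<Omega> h x"
proof -
  have "AE x in lebesgue. \<forall>j A. x \<in> \<Omega> \<longrightarrow> weak_partial \<Omega> j (\<lambda>y. (g y + h y) $ A) x =
      weak_partial \<Omega> j (\<lambda>y. g y $ A) x + weak_partial \<Omega> j (\<lambda>y. h y $ A) x"
  proof (intro eventually_all_finite)
    fix j A
    obtain v v' where "has_weak_partial \<Omega> j (\<lambda>x. g x $ A) v" "has_weak_partial \<Omega> j (\<lambda>x. h x $ A) v'"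
      using sobolev_space_0_weak_partial g h by metis
    from weak_partial_add[OF \<Omega> this]
    show "AE x in lebesgue. x \<in> \<Omega> \<longrightarrow> weak_partial \<Omega> j (\<lambda>y. (g y + h y) $ A) x =
        weak_partial \<Omega> j (\<lambda>y. g y $ A) x + weak_partial \<Omega> j (\<lambda>y. h y $ A) x"
      by simp
  qed
  then show ?thesis
  proof eventually_elim
    case (elim x)
    have vec_add: "(\<chi> A. p A + q A) = (\<chi> A. p A) + (\<chi> A. q A)" for p q :: "'a set \<Rightarrow> real"
      by (simp add: vec_eq_iff)
    show ?case
      using elim
      by (simp add: dirac_def vec_add linear_add[OF linear_cl_mult_right] sum.distrib del: vector_add_component)
  qed
qed

lemma dirac_scaleR:
  assumes \<Omega>: "open \<Omega>" and g: "g \<in> sobolev_space_0 \<Phi> \<Omega>"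
  shows "AE x in lebesgue. x \<in> \<Omega> \<longrightarrow> dirac \<Omega> (\<lambda>x. c *\<^sub>R g x) x = c *\<^sub>R dirac \<Omega> g x"
proof -
  have "AE x in lebesgue. \<forall>j A. x \<in> \<Omega> \<longrightarrow> weak_partial \<Omega> j (\<lambda>y. (c *\<^sub>R g y) $ A) x =
      c * weak_partial \<Omega> j (\<lambda>y. g y $ A) x"
  proof (intro eventually_all_finite)
    fix j A
    obtain v where "has_weak_partial \<Omega> j (\<lambda>x. g x $ A) v"
      using sobolev_space_0_weak_partial g by metis
    from weak_partial_cmult[OF \<Omega> this, of c]
    show "AE x in lebesgue. x \<in> \<Omega> \<longrightarrow> weak_partial \<Omega> j (\<lambda>y. (c *\<^sub>R g y) $ A) x =
        c * weak_partial \<Omega> j (\<lambda>y. g y $ A) x"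
      by simp
  qed
  then show ?thesis
  proof eventually_elim
    case (elim x)
    have vec_scale: "(\<chi> A. c * p A) = c *\<^sub>R (\<chi> A. p A)" for p :: "'a set \<Rightarrow> real"
      by (simp add: vec_eq_iff)
    show ?case
      using elim
      by (simp add: dirac_def vec_scale linear_cmul[OF linear_cl_mult_right] scaleR_sum_right
          del: vector_scaleR_component)
  qed
qed

text \<open>
  Expand the Clifford product into finitely many scalar pairings with constant Clifford
  coefficients, and add the bounds of the scalar pairings.
\<close>

lemma dirac_pairing_bounded:
  fixes f :: "real ^ 'n::{finite,linorder} \<Rightarrow> 'n clifford"
  assumes \<psi>: "orlicz_function \<psi>" and \<Omega>: "open \<Omega>" and f: "f \<in> orlicz_space \<psi> \<Omega>"
  obtains C where "\<And>g. g \<in> sobolev_space_0 (orlicz_conjugate \<psi>) \<Omega> \<Longrightarrow>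
      set_integrable lebesgue \<Omega> (\<lambda>x. cl_mult (cl_conj (f x)) (dirac \<Omega> g x))"
    and "\<And>g. g \<in> sobolev_space_0 (orlicz_conjugate \<psi>) \<Omega> \<Longrightarrow>
      ennreal (norm (cl_pairing \<Omega> f (dirac \<Omega> g))) \<le> ennreal C * sobolev_norm (orlicz_conjugate \<psi>) \<Omega> g"
proof -
  let ?W = "sobolev_space_0 (orlicz_conjugate \<psi>) \<Omega>"
  let ?P = "\<lambda>A c. 0 < c \<and> (\<forall>g\<in>?W. \<forall>j B.
      set_integrable lebesgue \<Omega> (\<lambda>x. f x $ A * weak_partial \<Omega> j (\<lambda>y. g y $ B) x) \<and>
      (\<integral>\<^sup>+x\<in>\<Omega>. ennreal \<bar>f x $ A * weak_partial \<Omega> j (\<lambda>y. g y $ B) x\<bar> \<partial>lebesgue) \<le>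
      ennreal c * sobolev_norm (orlicz_conjugate \<psi>) \<Omega> g)"
  have "\<exists>c. ?P A c" for A
    by (rule orlicz_sobolev_pairing[OF \<psi> \<Omega> f, of A], intro exI conjI ballI allI)
  then obtain c where P: "\<And>A. ?P A (c A)"
    using choice[of ?P] by blast
  have c: "0 < c A" for A using P by blast
  have int: "set_integrable lebesgue \<Omega> (\<lambda>x. f x $ A * weak_partial \<Omega> j (\<lambda>y. g y $ B) x)"
    and bound: "(\<integral>\<^sup>+x\<in>\<Omega>. ennreal \<bar>f x $ A * weak_partial \<Omega> j (\<lambda>y. g y $ B) x\<bar> \<partial>lebesgue) \<le>
      ennreal (c A) * sobolev_norm (orlicz_conjugate \<psi>) \<Omega> g" if "g \<in> ?W" for g A j B
    using P[of A] that by simp_all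
  define I where "I g A j B = (LINT x:\<Omega>|lebesgue. f x $ A * weak_partial \<Omega> j (\<lambda>y. g y $ B) x)"
    for g :: "(real, 'n) vec \<Rightarrow> 'n clifford" and A j B
  have expand: "indicator \<Omega> x *\<^sub>R cl_mult (cl_conj (f x)) (dirac \<Omega> g x) =
      (\<Sum>A\<in>UNIV. \<Sum>j\<in>UNIV. \<Sum>B\<in>UNIV.
        (indicator \<Omega> x *\<^sub>R (f x $ A
            * weak_partial \<Omega> j (\<lambda>y. g y $ B) x)) *\<^sub>R dirac_coefficient A j B)" for g x
    by (simp only: dirac_def clifford_pairing_expansion scaleR_sum_right scaleR_scaleR real_scaleR_def)
  have int': "integrable lebesgue (\<lambda>x. (indicator \<Omega> x *\<^sub>R (f x $ A * weak_partial \<Omega> j (\<lambda>y. g y $ B) x))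
      *\<^sub>R dirac_coefficient A j B)" if "g \<in> ?W" for g A j B
    using int[OF that] unfolding set_integrable_def by (rule integrable_scaleR_left)
  define C where "C = (\<Sum>A\<in>UNIV. \<Sum>j\<in>UNIV. \<Sum>B\<in>UNIV. c A * norm (dirac_coefficient A (j :: 'n) B))"
  show thesis
  proof
    fix g assume g: "g \<in> ?W"
    show "set_integrable lebesgue \<Omega> (\<lambda>x. cl_mult (cl_conj (f x)) (dirac \<Omega> g x))"
      unfolding set_integrable_def expand
      by (intro Bochner_Integration.integrable_sum int'[OF g])
    let ?N = "sobolev_norm (orlicz_conjugate \<psi>) \<Omega> g"
    have I_bound: "ennreal \<bar>I g A j B\<bar> \<le> ennreal (c A) * ?N" for A j B
    proof -
      have "ennreal (norm (I g A j B)) \<le>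
          (\<integral>\<^sup>+x. ennreal (norm (indicator \<Omega> x *\<^sub>R (f x $ A
              * weak_partial \<Omega> j (\<lambda>y. g y $ B) x))) \<partial>lebesgue)"
        unfolding I_def set_lebesgue_integral_def
        by (rule integral_norm_bound_ennreal) (use int[OF g] in \<open>simp add: set_integrable_def\<close>)
      also have "\<dots> = (\<integral>\<^sup>+x\<in>\<Omega>. ennreal \<bar>f x $ A * weak_partial \<Omega> j (\<lambda>y. g y $ B) x\<bar> \<partial>lebesgue)"
        by (intro nn_integral_cong) (simp add: indicator_def)
      also have "\<dots> \<le> ennreal (c A) * ?N" by (rule bound[OF g])
      finally show ?thesis by simp
    qed
    have "cl_pairing \<Omega> f (dirac \<Omega> g) =
        (\<Sum>A\<in>UNIV. \<Sum>j\<in>UNIV. \<Sum>B\<in>UNIV. I g A j B *\<^sub>R dirac_coefficient A j B)"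
      unfolding cl_pairing_def set_lebesgue_integral_def expand I_def
      by (simp only: Bochner_Integration.integral_sum Bochner_Integration.integrable_sum int'[OF g]
          integral_scaleR_left int[OF g, unfolded set_integrable_def])
    then have "norm (cl_pairing \<Omega> f (dirac \<Omega> g)) \<le>
        (\<Sum>A\<in>UNIV. \<Sum>j\<in>UNIV. \<Sum>B\<in>UNIV. \<bar>I g A j B\<bar> * norm (dirac_coefficient A j B))"
      by (auto intro!: order_trans[OF norm_sum] sum_mono)
    then have "ennreal (norm (cl_pairing \<Omega> f (dirac \<Omega> g))) \<le>
        (\<Sum>A\<in>UNIV. \<Sum>j\<in>UNIV. \<Sum>B\<in>UNIV. ennreal \<bar>I g A j B\<bar> * ennreal (norm (dirac_coefficient A j B)))"
      by (simp add: sum_nonneg flip: ennreal_mult)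
    also have "\<dots> \<le> (\<Sum>A\<in>UNIV. \<Sum>j\<in>UNIV. \<Sum>B\<in>UNIV.
        (ennreal (c A) * ?N) * ennreal (norm (dirac_coefficient A (j :: 'n) B)))"
      by (intro sum_mono mult_right_mono I_bound) auto
    also have "\<dots> = (\<Sum>A\<in>UNIV. \<Sum>j\<in>UNIV. \<Sum>B\<in>UNIV.
        ennreal (c A * norm (dirac_coefficient A (j :: 'n) B))) * ?N"
      using c by (simp add: sum_distrib_left ennreal_mult less_imp_le mult_ac)
    also have "\<dots> = ennreal C * ?N"
      unfolding C_def using c by (simp add: sum_nonneg less_imp_le)
    finally show "ennreal (norm (cl_pairing \<Omega> f (dirac \<Omega> g))) \<le> ennreal C * ?N" .
  qed
qed

text \<open>
  Also valid for \<open>N = 0\<close>, where the assumption forces \<open>a = 0\<close>, and for \<open>N = \<infinity>\<close>, where the quotient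
  is \<open>0\<close>. In the dual norm, \<open>N\<close> is a Luxemburg norm, an infimum that formally can take both values.
\<close>

lemma ennreal_divide_le_if_le_mult:
  fixes a N :: ennreal
  assumes "a \<le> c * N"
  shows "a / N \<le> c"
proof (cases "N = 0 \<or> N = top")
  case True
  with assms show ?thesis by auto
next
  case False
  then have "a / N \<le> c * N / N"
    using assms by (intro divide_right_mono_ennreal)
  also have "\<dots> = c"
    using False by (simp add: ennreal_mult_divide_eq)
  finally show ?thesis .
qed

theorem proposition4:
  fixes \<psi> :: "real \<Rightarrow> real"
    and \<Omega> :: "(real ^ 'n::{finite,linorder}) set"
  assumes "bounded_C1_domain \<Omega>"
    and "orlicz_function \<psi>"
  shows "(\<forall>f\<in>orlicz_space \<psi> \<Omega>. \<forall>g\<in>sobolev_space_0 (orlicz_conjugate \<psi>) \<Omega>.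
            set_integrable lebesgue \<Omega> (\<lambda>x. cl_mult (cl_conj (f x)) (dirac \<Omega> g x))) \<and>
         dirac_functional \<psi> \<Omega> \<in> orlicz_space \<psi> \<Omega> \<rightarrow> negative_sobolev_space \<psi> \<Omega>"
proof -
  let ?\<Phi> = "orlicz_conjugate \<psi>"
  let ?W = "sobolev_space_0 ?\<Phi> \<Omega>"
  have \<Omega>: "open \<Omega>" using assms(1) by (simp add: bounded_C1_domain_def)
  note add_closed = sobolev_space_0_add[OF orlicz_conjugate_mono orlicz_conjugate_borel \<Omega>]
  note scale_closed = sobolev_space_0_scaleR[OF orlicz_conjugate_mono \<Omega>]
  have integrable: "set_integrable lebesgue \<Omega> (\<lambda>x. cl_mult (cl_conj (f x)) (dirac \<Omega> g x))"
    if "f \<in> orlicz_space \<psi> \<Omega>" "g \<in> ?W" for f g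
    by (rule dirac_pairing_bounded[OF assms(2) \<Omega> that(1)]) (blast intro: that(2))
  have "dirac_functional \<psi> \<Omega> f \<in> negative_sobolev_space \<psi> \<Omega>" if f: "f \<in> orlicz_space \<psi> \<Omega>" for f
  proof -
    let ?F = "dirac_functional \<psi> \<Omega> f"
    have F: "?F g = cl_pairing \<Omega> f (dirac \<Omega> g)" if "g \<in> ?W" for g
      using that by (simp add: dirac_functional_def)
    have "?F g = ?F h" if "g \<in> ?W" "h \<in> ?W" "AE x in lebesgue. x \<in> \<Omega> \<longrightarrow> g x = h x" for g h
      using that by (simp add: F dirac_cong_AE[OF that(3)])
    moreover have "?F (\<lambda>x. g x + h x) = ?F g + ?F h" if g: "g \<in> ?W" and h: "h \<in> ?W" for g h
    proof -
      have "?F (\<lambda>x. g x + h x) = (LINT x:\<Omega>|lebesgue.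
          cl_mult (cl_conj (f x)) (dirac \<Omega> g x) + cl_mult (cl_conj (f x)) (dirac \<Omega> h x))"
        unfolding F[OF add_closed[OF g h]] cl_pairing_def
      proof (rule set_integral_cong_AE_lebesgue(2))
        show "AE x in lebesgue. x \<in> \<Omega> \<longrightarrow> cl_mult (cl_conj (f x)) (dirac \<Omega> (\<lambda>x. g x + h x) x) =
            cl_mult (cl_conj (f x)) (dirac \<Omega> g x) + cl_mult (cl_conj (f x)) (dirac \<Omega> h x)"
          using dirac_add[OF \<Omega> g h]
          by eventually_elim (simp add: linear_add[OF linear_cl_mult_right])
      qed
      also have "\<dots> = ?F g + ?F h"
        unfolding F[OF g] F[OF h] cl_pairing_def
        by (intro set_integral_add integrable f g h)
      finally show ?thesis .
    qed
    moreover have "?F (\<lambda>x. c *\<^sub>R g x) = c *\<^sub>R ?F g" if g: "g \<in> ?W" for g c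
    proof -
      have "?F (\<lambda>x. c *\<^sub>R g x) = (LINT x:\<Omega>|lebesgue. c *\<^sub>R cl_mult (cl_conj (f x)) (dirac \<Omega> g x))"
        unfolding F[OF scale_closed[OF g]] cl_pairing_def
      proof (rule set_integral_cong_AE_lebesgue(2))
        show "AE x in lebesgue. x \<in> \<Omega> \<longrightarrow> cl_mult (cl_conj (f x)) (dirac \<Omega> (\<lambda>x. c *\<^sub>R g x) x) =
            c *\<^sub>R cl_mult (cl_conj (f x)) (dirac \<Omega> g x)"
          using dirac_scaleR[OF \<Omega> g, of c]
          by eventually_elim (simp add: linear_cmul[OF linear_cl_mult_right])
      qed
      then show ?thesis
        by (simp add: F[OF g] cl_pairing_def)
    qed
    moreover have "dual_norm \<psi> \<Omega> ?F < \<infinity>"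
    proof -
      obtain C where C: "\<And>g. g \<in> ?W \<Longrightarrow>
          ennreal (norm (cl_pairing \<Omega> f (dirac \<Omega> g))) \<le> ennreal C * sobolev_norm ?\<Phi> \<Omega> g"
        by (rule dirac_pairing_bounded[OF assms(2) \<Omega> f]) blast
      have "dual_norm \<psi> \<Omega> ?F \<le> ennreal C"
        unfolding dual_norm_def
        by (intro SUP_least ennreal_divide_le_if_le_mult) (auto simp: F C)
      then show ?thesis
        by (rule le_less_trans) simp
    qed
    moreover have "?F \<in> extensional ?W"
      by (simp add: dirac_functional_def)
    ultimately show ?thesis
      unfolding negative_sobolev_space_def Let_def by blast
  qed
  with integrable show ?thesis by blast
qed

end
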